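(* Let $\gamma\in(0,1)$, $d\in\mathbb N$, $T>0$, and let $\mathbf n$ denote the integer part of $1/\gamma$. The maps $$I_1^\gamma:\bar{\mathrm R}^\gamma([0,T],\mathbb R^d)\to\mathrm R^\gamma([0,T],\mathbb R^d),\quad \bar{\mathbf X}\mapsto\mathbf X,\ \ \mathbf X_t:=\pi^{\mathbf n}\bar{\mathbf X}_t,$$ $$I_2^\gamma:\mathrm R^\gamma([0,T],\mathbb R^d)\to\check{\mathrm R}^\gamma([0,T],\mathbb R^d),\quad \mathbf X\mapsto\check{\mathbf X},\ \ \check{\mathbf X}_{st}(w):=\langle w,\mathbf X_{st}\rangle,$$ $$I_3^\gamma:\bar{\mathrm R}^\gamma([0,T],\mathbb R^d)\to\hat{\mathrm R}^\gamma([0,T],\mathbb R^d),\quad \bar{\mathbf X}\mapsto\hat{\mathbf X},\ \ \hat{\mathbf X}_{st}(w):=\langle w,\bar{\mathbf X}_{st}\rangle$$ are well-defined and bijective.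
   Context: Words: $\mathcal W_d$ is the set of words $e_{i_1\cdots i_n}$ ($n\ge 1$, $i_j\in\{1,\dots,d\}$) together with the empty word $\mathbf 1$; $|w|$ is the length; $\mathcal W_d^n:=\{w:|w|\le n\}$. $\langle M\rangle$ is the real vector space with basis $M$ and $V^*$ the algebraic dual. $\langle\mathcal W_d\rangle$ is identified with the tensor algebra $\mathrm T(\mathbb R^d)$, with concatenation product $\dot\otimes$; $\mathrm T((\mathbb R^d))=\prod_{m\ge0}(\mathbb R^d)^{\dot\otimes m}$ is the space of formal series, $\mathrm T^n(\mathbb R^d)=\bigoplus_{m\le n}(\mathbb R^d)^{\dot\otimes m}=\langle\mathcal W_d^n\rangle$; $\pi_m$ is the projection onto degree $m$ and $\pi^n$ the projection onto $\mathrm T^n(\mathbb R^d)$; $\dot\otimes_n$ is the truncated product $x\,\dot\otimes_n\,y=\pi^n(x\dot\otimes y)$. $\langle\cdot,\cdot\rangle$ is the bilinear pairing with $\langle w_1,w_2\rangle=\delta_{w_1,w_2}$ on words (extended to pair polynomials with series), and $\|l\|:=\sqrt{\langle l,l\rangle}$ on $\mathrm T^n(\mathbb R^d)$. $\sqcup\!\sqcup$ is the shuffle product on $\langle\mathcal W_d\rangle$, $\Delta_{\sqcup\!\sqcup}$ its dual coproduct (the algebra homomorphism for $\dot\otimes$ with $\Delta_{\sqcup\!\sqcup}v=\mathbf 1\otimes v+v\otimes\mathbf 1$ for $v\in\mathbb R^d$, extended degreewise to series), and $\Delta_{\dot\otimes}$ is deconcatenation, $\Delta_{\dot\otimes}e_{i_1\cdots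 i_n}=\sum_{k=0}^n e_{i_1\cdots i_k}\otimes e_{i_{k+1}\cdots i_n}$. $\varepsilon$ is the counit, $\varepsilon(w)=\delta_{w,\mathbf 1}$, and $\varepsilon_{\mathbf n}$ its restriction to $\langle\mathcal W_d^{\mathbf n}\rangle$. Groups: $\mathrm G_d:=\{g\in\mathrm T((\mathbb R^d))\setminus\{0\}:\Delta_{\sqcup\!\sqcup}g=g\otimes g\}$ (group under $\dot\otimes$) and $\mathrm G^n_d:=\{g\in\mathrm T^n(\mathbb R^d)\setminus\{0\}:\Delta_{\sqcup\!\sqcup}g=\pi^n(g\otimes g)\}$ (group under $\dot\otimes_n$), where here $\pi^n$ on tensors keeps the components of total degree at most $n$. For $g\in\mathrm G^n_d$, $\|g\|_{\mathrm G^n_d}:=\sum_{m=1}^n\|\pi_m\log_{\dot\otimes_n}(g)\|^{1/m}$, with $\log_{\dot\otimes_n}(\mathbf 1+u)=\sum_{k\ge1}\frac{(-1)^{k-1}}{k}u^{\dot\otimes_n k}$. Four definitions of $d$-dimensional $\gamma$-Hölder weakly geometric rough paths: (1) $\mathrm R^\gamma([0,T],\mathbb R^d)$: maps $\mathbf X:[0,T]\to\mathrm G^{\mathbf n}_d$ with $\mathbf X_0=\mathbf 1$ and $\sup_{s<t}\|\mathbf X_{st}\|_{\mathrm G^{\mathbf n}_d}/|t-s|^\gamma<\infty$, where $\mathbf X_{st}:=\mathbf X_s^{-1}\dot\otimes_{\mathbf n}\mathbf X_t$ (inverse in $\mathrm G^{\mathbf n}_d$). (2) $\bar{\mathrm R}^\gamma([0,T],\mathbb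 R^d)$: maps $\bar{\mathbf X}:[0,T]\to\mathrm G_d$ with $\bar{\mathbf X}_0=\mathbf 1$ and $\sup_{s<t}\|\pi^n\bar{\mathbf X}_{st}\|_{\mathrm G^n_d}/|t-s|^\gamma<\infty$ for all $n\in\mathbb N$, where $\bar{\mathbf X}_{st}:=\bar{\mathbf X}_s^{-1}\dot\otimes\bar{\mathbf X}_t$. (3) $\check{\mathrm R}^\gamma([0,T],\mathbb R^d)$: maps $\check{\mathbf X}:[0,T]^2\to\langle\mathcal W_d^{\mathbf n}\rangle^*$ such that: $\check{\mathbf X}_{st}(\mathbf 1)=1$ and $\check{\mathbf X}_{st}(w_1\sqcup\!\sqcup w_2)=\check{\mathbf X}_{st}(w_1)\check{\mathbf X}_{st}(w_2)$ for all words with $|w_1|+|w_2|\le\mathbf n$; $\check{\mathbf X}_{tt}=\varepsilon_{\mathbf n}$ and $\check{\mathbf X}_{st}(w)=(\check{\mathbf X}_{su}\otimes\check{\mathbf X}_{ut})\Delta_{\dot\otimes}w$ for all $w\in\mathcal W_d^{\mathbf n}$, $s,u,t\in[0,T]$; $\sup_{s\ne t}|\check{\mathbf X}_{st}(w)|/|t-s|^{\gamma|w|}<\infty$ for all $w\in\mathcal W_d^{\mathbf n}$. (4) $\hat{\mathrm R}^\gamma([0,T],\mathbb R^d)$: maps $\hat{\mathbf X}:[0,T]^2\to\langle\mathcal W_d\rangle^*$ such that: $\hat{\mathbf X}_{st}(\mathbf 1)=1$ and $\hat{\mathbf X}_{st}(w_1\sqcup\!\sqcup w_2)=\hat{\mathbf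 X}_{st}(w_1)\hat{\mathbf X}_{st}(w_2)$ for all words; $\hat{\mathbf X}_{tt}=\varepsilon$ and $\hat{\mathbf X}_{st}(w)=(\hat{\mathbf X}_{su}\otimes\hat{\mathbf X}_{ut})\Delta_{\dot\otimes}w$ for all words $w$ and $s,u,t\in[0,T]$; $\sup_{s\neq t}|\hat{\mathbf X}_{st}(w)|/|t-s|^{\gamma|w|}<\infty$ for all words $w$. *)

theory Defs
  imports Complex_Main "HOL-Algebra.Group" "HOL-Library.FuncSet"
begin

(* Letters are the elements of a finite type 'd, the dimension d being CARD('d).  Words are lists;
   the formal series in T((R^d)) are arbitrary functions on words, and T(R^d) and T^n(R^d) are the
   subsets of those functions with finite support, respectively with support in words of length
   at most n. *)

type_synonym 'd series = "'d list \<Rightarrow> real"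
type_synonym 'd series2 = "'d list \<times> 'd list \<Rightarrow> real"

definition word :: "'d list \<Rightarrow> 'd series"
  where "word w = (\<lambda>v. if v = w then 1 else 0)"

definition zero :: "'d series"
  where "zero = (\<lambda>_. 0)"

definition unit :: "'d series"
  where "unit = word []"

definition free_space :: "'d list set \<Rightarrow> 'd series set"
  where "free_space M = {p. finite {w. p w \<noteq> 0} \<and> {w. p w \<noteq> 0} \<subseteq> M}"

definition words_upto :: "nat \<Rightarrow> 'd list set"
  where "words_upto n = {w. length w \<le> n}"

abbreviation trunc_space :: "nat \<Rightarrow> 'd series set"
  where "trunc_space n \<equiv> free_space (words_upto n)"

definition pairing :: "'d series \<Rightarrow> 'd series \<Rightarrow> real"
  where "pairing p x = (\<Sum>w | p w \<noteq> 0. p w * x w)"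

definition tnorm :: "'d series \<Rightarrow> real"
  where "tnorm l = sqrt (pairing l l)"

definition proj :: "nat \<Rightarrow> 'd series \<Rightarrow> 'd series"
  where "proj m x = (\<lambda>w. if length w = m then x w else 0)"

definition trunc :: "nat \<Rightarrow> 'd series \<Rightarrow> 'd series"
  where "trunc n x = (\<lambda>w. if length w \<le> n then x w else 0)"

definition conc :: "'d series \<Rightarrow> 'd series \<Rightarrow> 'd series"
  where "conc x y = (\<lambda>w. \<Sum>(u, v) \<in> {(u, v). u @ v = w}. x u * y v)"

definition conc_trunc :: "nat \<Rightarrow> 'd series \<Rightarrow> 'd series \<Rightarrow> 'd series"
  where "conc_trunc n x y = trunc n (conc x y)"

(* Tensor squares: a function on pairs of words (u, v) lists the coefficients of the elementary
   tensors u (x) v, so that arbitrary functions form the completed tensor square of T((R^d)). *)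

definition tensor :: "'d series \<Rightarrow> 'd series \<Rightarrow> 'd series2"
  where "tensor x y = (\<lambda>(u, v). x u * y v)"

definition trunc2 :: "nat \<Rightarrow> 'd series2 \<Rightarrow> 'd series2"
  where "trunc2 n a = (\<lambda>(u, v). if length u + length v \<le> n then a (u, v) else 0)"

definition conc2 :: "'d series2 \<Rightarrow> 'd series2 \<Rightarrow> 'd series2"
  where "conc2 a b = (\<lambda>(u, v). \<Sum>(u1, u2) \<in> {(u1, u2). u1 @ u2 = u}.
           \<Sum>(v1, v2) \<in> {(v1, v2). v1 @ v2 = v}. a (u1, v1) * b (u2, v2))"

fun shuffle :: "'d list \<Rightarrow> 'd list \<Rightarrow> 'd series"
  where
    "shuffle [] v = word v"
  | "shuffle (i # u) [] = word (i # u)"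
  | "shuffle (i # u) (j # v) =
       (\<lambda>w. conc (word [i]) (shuffle u (j # v)) w + conc (word [j]) (shuffle (i # u) v) w)"

primrec coshuffle_word :: "'d list \<Rightarrow> 'd series2"
  where
    "coshuffle_word [] = tensor unit unit"
  | "coshuffle_word (i # w) =
       conc2 (\<lambda>p. tensor unit (word [i]) p + tensor (word [i]) unit p) (coshuffle_word w)"

(* The coproduct preserves the total degree, so only words of length |u| + |v| contribute to the
   coefficient at (u, v); this is the degreewise extension to formal series. *)

definition coshuffle :: "('d::finite) series \<Rightarrow> 'd series2"
  where "coshuffle x = (\<lambda>(u, v). \<Sum>w | length w = length u + length v. x w * coshuffle_word w (u, v))"

(* coshuffle is indeed the dual of the shuffle product. *)

lemma finite_splits: "finite {(u, v). u @ v = w}"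
proof (rule finite_subset)
  show "{(u, v). u @ v = w} \<subseteq> (\<lambda>k. (take k w, drop k w)) ` {..length w}"
  proof clarify
    fix u v assume "w = u @ v"
    then show "(u, v) \<in> (\<lambda>k. (take k (u @ v), drop k (u @ v))) ` {..length (u @ v)}"
      by (intro image_eqI[of _ _ "length u"]) simp_all
  qed
qed simp

lemma conc_word: "conc (word [i]) x w = (case w of [] \<Rightarrow> 0 | k # w' \<Rightarrow> if k = i then x w' else 0)"
proof -
  have "conc (word [i]) x w = (\<Sum>p\<in>{(u, v). u @ v = w}. if fst p = [i] then x (snd p) else 0)"
    unfolding conc_def by (rule sum.cong) (auto simp: word_def)
  also have "\<dots> = (\<Sum>p\<in>{p\<in>{(u, v). u @ v = w}. fst p = [i]}. x (snd p))"
    by (subst sum.inter_filter[OF finite_splits]) simp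
  also have "{p\<in>{(u, v). u @ v = w}. fst p = [i]} =
     (case w of [] \<Rightarrow> {} | k # w' \<Rightarrow> if k = i then {([i], w')} else {})"
    by (auto split: list.split)
  finally show ?thesis by (auto split: list.split)
qed

lemma conc2_unit1: "conc2 (tensor unit x) b (u, v) = conc x (\<lambda>v'. b (u, v')) v"
proof -
  have *: "(\<Sum>(v1, v2) \<in> {(v1, v2). v1 @ v2 = v}. tensor unit x (u1, v1) * b (u2, v2)) =
      (if u1 = [] then conc x (\<lambda>v'. b (u2, v')) v else 0)" for u1 u2
    by (cases "u1 = []") (simp_all add: tensor_def unit_def word_def conc_def)
  have "conc2 (tensor unit x) b (u, v) =
      (\<Sum>p\<in>{(u1, u2). u1 @ u2 = u}. if p = ([], u) then conc x (\<lambda>v'. b (u, v')) v else 0)"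
    unfolding conc2_def prod.case * by (rule sum.cong) (auto split: if_splits)
  then show ?thesis using finite_splits[of u] by simp
qed

lemma conc2_unit2: "conc2 (tensor x unit) b (u, v) = conc x (\<lambda>u'. b (u', v)) u"
proof -
  have "(\<Sum>(v1, v2) \<in> {(v1, v2). v1 @ v2 = v}. tensor x unit (u1, v1) * b (u2, v2)) = x u1 * b (u2, v)"
    for u1 u2
  proof -
    have "(\<Sum>(v1, v2) \<in> {(v1, v2). v1 @ v2 = v}. tensor x unit (u1, v1) * b (u2, v2)) =
        (\<Sum>p\<in>{(v1, v2). v1 @ v2 = v}. if p = ([], v) then x u1 * b (u2, v) else 0)"
      by (rule sum.cong) (auto simp: word_def tensor_def unit_def split: if_splits)
    then show ?thesis using finite_splits[of v] by simp
  qed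
  then show ?thesis
    unfolding conc2_def prod.case conc_def by simp
qed

lemma conc2_add: "conc2 (\<lambda>p. a p + a' p) b q = conc2 a b q + conc2 a' b q"
  by (cases q) (simp add: conc2_def sum.distrib distrib_right case_prod_unfold)

lemma shuffle_Nil: "shuffle u [] = word u"
  by (cases u) simp_all

lemma coshuffle_word_Cons:
  "coshuffle_word (i # w) (u, v) =
     (case v of [] \<Rightarrow> 0 | k # v' \<Rightarrow> if k = i then coshuffle_word w (u, v') else 0) +
     (case u of [] \<Rightarrow> 0 | k # u' \<Rightarrow> if k = i then coshuffle_word w (u', v) else 0)"
  by (simp add: conc2_add conc2_unit1 conc2_unit2 conc_word)

lemma coshuffle_word_eq: "coshuffle_word w (u, v) = shuffle u v w"
proof (induction w arbitrary: u v)
  case Nil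
  show ?case
    by (cases u; cases v) (simp_all add: tensor_def unit_def conc_word, simp_all add: word_def)
next
  case (Cons i w)
  show ?case
    unfolding coshuffle_word_Cons Cons
    by (cases u; cases v) (simp_all add: conc_word shuffle_Nil, simp_all add: word_def)
qed

lemma shuffle_length: "shuffle u v w \<noteq> 0 \<Longrightarrow> length w = length u + length v"
proof (induction w arbitrary: u v)
  case Nil
  then show ?case
    by (cases u; cases v) (simp_all add: conc_word, simp_all add: word_def split: if_splits)
next
  case (Cons i w)
  then have "(case v of [] \<Rightarrow> 0 | k # v' \<Rightarrow> if k = i then shuffle u v' w else 0) \<noteq> 0 \<or>
      (case u of [] \<Rightarrow> 0 | k # u' \<Rightarrow> if k = i then shuffle u' v w else 0) \<noteq> 0"
    unfolding coshuffle_word_eq[symmetric] coshuffle_word_Cons by linarith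
  then show ?case
    by (cases u; cases v) (auto dest: Cons.IH simp: word_def split: if_splits)
qed

lemma coshuffle_dual:
  fixes x :: "('d::finite) series"
  shows "coshuffle x (u, v) = pairing (shuffle u v) x"
proof -
  have "finite {w :: 'd list. length w = length u + length v}"
    using finite_lists_length_eq[of "UNIV :: 'd set" "length u + length v"] by simp
  then show ?thesis
    unfolding coshuffle_def pairing_def prod.case coshuffle_word_eq
    by (intro sum.mono_neutral_cong_right) (auto dest: shuffle_length)
qed

definition deconc_word :: "'d list \<Rightarrow> 'd series2"
  where "deconc_word w = (\<lambda>p. \<Sum>k\<le>length w. tensor (word (take k w)) (word (drop k w)) p)"

definition tensor_functional :: "('d series \<Rightarrow> real) \<Rightarrow> ('d series \<Rightarrow> real) \<Rightarrow> 'd series2 \<Rightarrow> real"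
  where "tensor_functional f h a = (\<Sum>(u, v) | a (u, v) \<noteq> 0. a (u, v) * (f (word u) * h (word v)))"

(* Functionals are made extensional (undefined outside V) so that equality of functionals is
   equality on V; likewise for the paths below, which are undefined outside [0, T] or [0, T]^2. *)

definition dual :: "'d series set \<Rightarrow> ('d series \<Rightarrow> real) set"
  where "dual V = {f \<in> extensional V.
           (\<forall>p\<in>V. \<forall>q\<in>V. f (\<lambda>w. p w + q w) = f p + f q) \<and> (\<forall>c. \<forall>p\<in>V. f (\<lambda>w. c * p w) = c * f p)}"

definition counit :: "'d series set \<Rightarrow> 'd series \<Rightarrow> real"
  where "counit V = restrict (\<lambda>p. p []) V"

definition G :: "('d::finite) series monoid"
  where "G = \<lparr>carrier = {g. g \<noteq> zero \<and> coshuffle g = tensor g g}, mult = conc, one = unit\<rparr>"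

definition G_trunc :: "nat \<Rightarrow> ('d::finite) series monoid"
  where "G_trunc n = \<lparr>carrier = {g \<in> trunc_space n. g \<noteq> zero \<and> coshuffle g = trunc2 n (tensor g g)},
           mult = conc_trunc n, one = unit\<rparr>"

definition T_trunc :: "nat \<Rightarrow> 'd series monoid"
  where "T_trunc n = \<lparr>carrier = trunc_space n, mult = conc_trunc n, one = unit\<rparr>"

(* Coefficientwise sum over k >= 1, shifted to start at 0.  The argument is meant to have constant
   coefficient 1, so that only finitely many summands are non-zero. *)

definition log_trunc :: "nat \<Rightarrow> 'd series \<Rightarrow> 'd series"
  where "log_trunc n g = (\<lambda>w. \<Sum>k. (- 1) ^ k / real (Suc k) *
           ((\<lambda>v. g v - unit v) [^]\<^bsub>T_trunc n\<^esub> Suc k) w)"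

definition G_norm :: "nat \<Rightarrow> 'd series \<Rightarrow> real"
  where "G_norm n g = (\<Sum>m=1..n. tnorm (proj m (log_trunc n g)) powr (1 / real m))"

definition increment :: "('d series, 'b) monoid_scheme \<Rightarrow> (real \<Rightarrow> 'd series) \<Rightarrow> real \<Rightarrow> real \<Rightarrow> 'd series"
  where "increment H X s t = inv\<^bsub>H\<^esub> (X s) \<otimes>\<^bsub>H\<^esub> X t"

definition level :: "real \<Rightarrow> nat"
  where "level \<gamma> = nat \<lfloor>1 / \<gamma>\<rfloor>"

definition R :: "real \<Rightarrow> real \<Rightarrow> (real \<Rightarrow> ('d::finite) series) set"
  where "R \<gamma> T = {X \<in> {0..T} \<rightarrow>\<^sub>E carrier (G_trunc (level \<gamma>)). X 0 = unit \<and>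
    bdd_above {G_norm (level \<gamma>) (increment (G_trunc (level \<gamma>)) X s t) / \<bar>t - s\<bar> powr \<gamma> | s t.
      s \<in> {0..T} \<and> t \<in> {0..T} \<and> s < t}}"

definition R_bar :: "real \<Rightarrow> real \<Rightarrow> (real \<Rightarrow> ('d::finite) series) set"
  where "R_bar \<gamma> T = {X \<in> {0..T} \<rightarrow>\<^sub>E carrier G. X 0 = unit \<and>
    (\<forall>n. bdd_above {G_norm n (trunc n (increment G X s t)) / \<bar>t - s\<bar> powr \<gamma> | s t.
      s \<in> {0..T} \<and> t \<in> {0..T} \<and> s < t})}"

definition R_check :: "real \<Rightarrow> real \<Rightarrow> (real \<times> real \<Rightarrow> 'd series \<Rightarrow> real) set"
  where "R_check \<gamma> T = {X \<in> {0..T} \<times> {0..T} \<rightarrow>\<^sub>E dual (trunc_space (level \<gamma>)).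
    (\<forall>s\<in>{0..T}. \<forall>t\<in>{0..T}. X (s, t) unit = 1 \<and>
      (\<forall>w1 w2. length w1 + length w2 \<le> level \<gamma> \<longrightarrow>
        X (s, t) (shuffle w1 w2) = X (s, t) (word w1) * X (s, t) (word w2))) \<and>
    (\<forall>t\<in>{0..T}. X (t, t) = counit (trunc_space (level \<gamma>))) \<and>
    (\<forall>s\<in>{0..T}. \<forall>u\<in>{0..T}. \<forall>t\<in>{0..T}. \<forall>w\<in>words_upto (level \<gamma>).
      X (s, t) (word w) = tensor_functional (X (s, u)) (X (u, t)) (deconc_word w)) \<and>
    (\<forall>w\<in>words_upto (level \<gamma>).
      bdd_above {\<bar>X (s, t) (word w)\<bar> / \<bar>t - s\<bar> powr (\<gamma> * real (length w)) | s t.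
        s \<in> {0..T} \<and> t \<in> {0..T} \<and> s \<noteq> t})}"

definition R_hat :: "real \<Rightarrow> real \<Rightarrow> (real \<times> real \<Rightarrow> 'd series \<Rightarrow> real) set"
  where "R_hat \<gamma> T = {X \<in> {0..T} \<times> {0..T} \<rightarrow>\<^sub>E dual (free_space UNIV).
    (\<forall>s\<in>{0..T}. \<forall>t\<in>{0..T}. X (s, t) unit = 1 \<and>
      (\<forall>w1 w2. X (s, t) (shuffle w1 w2) = X (s, t) (word w1) * X (s, t) (word w2))) \<and>
    (\<forall>t\<in>{0..T}. X (t, t) = counit (free_space UNIV)) \<and>
    (\<forall>s\<in>{0..T}. \<forall>u\<in>{0..T}. \<forall>t\<in>{0..T}. \<forall>w.
      X (s, t) (word w) = tensor_functional (X (s, u)) (X (u, t)) (deconc_word w)) \<and>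
    (\<forall>w. bdd_above {\<bar>X (s, t) (word w)\<bar> / \<bar>t - s\<bar> powr (\<gamma> * real (length w)) | s t.
        s \<in> {0..T} \<and> t \<in> {0..T} \<and> s \<noteq> t})}"

definition I1 :: "real \<Rightarrow> real \<Rightarrow> (real \<Rightarrow> 'd series) \<Rightarrow> (real \<Rightarrow> 'd series)"
  where "I1 \<gamma> T X = (\<lambda>t\<in>{0..T}. trunc (level \<gamma>) (X t))"

definition I2 :: "real \<Rightarrow> real \<Rightarrow> (real \<Rightarrow> ('d::finite) series) \<Rightarrow> (real \<times> real \<Rightarrow> 'd series \<Rightarrow> real)"
  where "I2 \<gamma> T X = (\<lambda>(s, t)\<in>{0..T} \<times> {0..T}. \<lambda>p\<in>trunc_space (level \<gamma>).
           pairing p (increment (G_trunc (level \<gamma>)) X s t))"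

definition I3 :: "real \<Rightarrow> (real \<Rightarrow> ('d::finite) series) \<Rightarrow> (real \<times> real \<Rightarrow> 'd series \<Rightarrow> real)"
  where "I3 T X = (\<lambda>(s, t)\<in>{0..T} \<times> {0..T}. \<lambda>p\<in>free_space UNIV. pairing p (increment G X s t))"

end

theory Submission
  imports Defs "HOL-Library.Landau_Symbols"
begin

text \<open>
  All four kinds of rough path are determined by their coefficients on words, so the work is to
  match the conditions imposed on these coefficients and to show that the coefficients on words
  of length at most $\lfloor 1/\gamma \rfloor$ determine all others.

  \<^emph>\<open>Groups.\<close> The coefficient recursion \<open>conc_Cons\<close> makes formal series an associative algebra in
  which a series with constant coefficient 1 is invertible. The shuffle coproduct is
  multiplicative (\<open>coshuffle_conc\<close>), whence products and inverses of group-like series are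
  group-like. All this respects any set of words that is closed under passing to words of at most
  the same length, so that the truncated and the full group are instances of one development.

  \<^emph>\<open>Norms.\<close> The coefficient of $\log g$ at a word $w$ is that of $g$ plus a polynomial in
  coefficients of $g$ at shorter words, homogeneous of degree $|w|$. By induction on $|w|$ the
  homogeneous norm of $\mathbf{X}_{st}$ is $O(|t-s|^{\gamma})$ if and only if each coefficient at $w$ is
  $O(|t-s|^{\gamma |w|})$ (\<open>G_norm_bound_iff\<close>). The coefficientwise bound is inherited by inverses,
  which is why it may be imposed for $s < t$ or for all $s$ and $t$ alike. The
  group-valued and the functional-valued definitions are thereby translated into one another by
  duality (\<open>bij_betw_to_dual\<close>).

  \<^emph>\<open>Extension.\<close> Let $\gamma(m+1) > 1$ and let the levels up to $m$ be given. By Chen's relation, a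
  coefficient of level $m+1$ is a function $F$ with prescribed increments up to an error
  $O(|t-s|^{\gamma(m+1)})$. The prescription is additive up to an error of the same size, and since
  the exponent exceeds 1, such an $F$ exists by sewing (\<open>sewing\<close>). Two choices of $F$ differ
  by a function that is Hoelder continuous of order greater than 1, hence constant
  (\<open>hoelder_gt_one_constant\<close>). The same argument shows that the new level is automatically
  group-like: the defect of the shuffle relation at level $m+1$, as a function of time, has
  increments $O(|t-s|^{\gamma(m+1)})$ and starts at 0. Iterating over $m$ gives the inverse of
  the truncation map.
\<close>

section \<open>Concatenation of formal series\<close>

definition splits :: "'d list \<Rightarrow> ('d list \<times> 'd list) set"
  where "splits w = {(u, v). u @ v = w}"

lemma finite_splits_set [simp]: "finite (splits w)"
  unfolding splits_def by (rule finite_splits)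

lemma sum_splits_Nil: "sum f (splits []) = f ([], [])"
  by (simp add: splits_def)

lemma sum_splits_Cons:
  "sum f (splits (i # w)) = f ([], i # w) + (\<Sum>(u, v)\<in>splits w. f (i # u, v))"
proof -
  have "splits (i # w) = insert ([], i # w) ((\<lambda>(u, v). (i # u, v)) ` splits w)"
    by (auto simp: splits_def append_eq_Cons_conv image_iff)
  moreover have "([], i # w) \<notin> (\<lambda>(u, v). (i # u, v)) ` splits w" by auto
  moreover have "sum f ((\<lambda>(u, v). (i # u, v)) ` splits w) = (\<Sum>(u, v)\<in>splits w. f (i # u, v))"
    by (subst sum.reindex) (auto simp: inj_on_def case_prod_unfold)
  ultimately show ?thesis by simp
qed

lemma conc_splits: "conc x y w = (\<Sum>(u, v)\<in>splits w. x u * y v)"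
  by (simp add: conc_def splits_def)

lemma conc_Nil: "conc x y [] = x [] * y []"
  by (simp add: conc_splits sum_splits_Nil)

text \<open>
  Together with \<open>conc_Nil\<close> this is a recursion for the product on the letters of the word, in which
  the left factor is replaced by its left quotient by a letter. The identities for products below
  are proved by induction along this recursion.
\<close>

lemma conc_Cons: "conc x y (i # w) = x [] * y (i # w) + conc (\<lambda>v. x (i # v)) y w"
  by (simp add: conc_splits sum_splits_Cons)

lemma conc_add_left: "conc (\<lambda>w. x w + y w) z v = conc x z v + conc y z v"
  by (simp add: conc_splits distrib_right case_prod_unfold sum.distrib)

lemma conc_scale_left: "conc (\<lambda>w. c * x w) z v = c * conc x z v"
  by (simp add: conc_splits case_prod_unfold sum_distrib_left mult.assoc)

text \<open>
  The product is graded: its coefficient at a word of length $n$ sees the factors only up to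
  length $n$. This is what makes truncation compatible with all constructions.
\<close>

lemma conc_cong:
  assumes "\<And>u. length u \<le> length w \<Longrightarrow> x u = x' u" "\<And>u. length u \<le> length w \<Longrightarrow> y u = y' u"
  shows "conc x y w = conc x' y' w"
  unfolding conc_splits by (rule sum.cong) (auto simp: splits_def intro!: arg_cong2[of _ _ _ _ "(*)"] assms)

lemma conc_assoc: "conc (conc x y) z = conc x (conc y z)"
proof
  show "conc (conc x y) z w = conc x (conc y z) w" for w
    by (induction w arbitrary: x)
      (simp_all add: conc_Nil conc_Cons conc_add_left conc_scale_left algebra_simps)
qed

lemma unit_Nil [simp]: "unit [] = 1" and unit_Cons [simp]: "unit (i # w) = 0"
  by (simp_all add: unit_def word_def)

lemma conc_zero_left: "conc (\<lambda>v. 0) x w = 0"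
  by (simp add: conc_splits case_prod_unfold)

lemma conc_unit_left [simp]: "conc unit x = x"
proof
  show "conc unit x w = x w" for w
    by (cases w) (simp_all add: conc_Nil conc_Cons conc_zero_left)
qed

lemma conc_unit_right [simp]: "conc x unit = x"
proof
  show "conc x unit w = x w" for w
    by (induction w arbitrary: x) (simp_all add: conc_Nil conc_Cons)
qed

text \<open>
  Both trivial factorisations are removed. In a product of two series with constant coefficient 1
  they contribute the coefficients of the factors themselves, and what remains involves shorter
  words only; inductions on the level rest on this.
\<close>

definition proper_splits :: "'d list \<Rightarrow> ('d list \<times> 'd list) set"
  where "proper_splits w = splits w - {([], w), (w, [])}"

lemma proper_splitsD:
  assumes "(u, v) \<in> proper_splits w"
  shows "length u < length w" "length v < length w" "length u + length v = length w"
  using assms by (auto simp: proper_splits_def splits_def)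

lemma conc_proper:
  assumes "w \<noteq> []"
  shows "conc x y w = x [] * y w + x w * y [] + (\<Sum>(u, v)\<in>proper_splits w. x u * y v)"
  unfolding conc_splits proper_splits_def
  by (subst sum.subset_diff[of "{([], w), (w, [])}"]) (use assms in \<open>auto simp: splits_def finite_splits\<close>)

text \<open>
  The equation $x \cdot x^{-1} = 1$, read at the word $i w$ and solved for the coefficient of the inverse
  at $i w$, for a series $x$ with constant coefficient 1.
\<close>

fun conc_inverse :: "'d series \<Rightarrow> 'd list \<Rightarrow> real" where
  "conc_inverse x [] = 1"
| "conc_inverse x (i # w) = - (\<Sum>k\<le>length w. x (i # take k w) * conc_inverse x (drop k w))"

lemma conc_take_drop: "conc x y w = (\<Sum>k\<le>length w. x (take k w) * y (drop k w))"
proof (induction w arbitrary: x)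
  case (Cons i w)
  then show ?case by (simp add: conc_Cons sum.atMost_Suc_shift del: sum.atMost_Suc)
qed (simp add: conc_Nil)

lemma conc_inverse_right:
  assumes "x [] = 1"
  shows "conc x (conc_inverse x) = unit"
proof
  show "conc x (conc_inverse x) w = unit w" for w
    by (cases w) (simp_all add: conc_Nil conc_Cons conc_take_drop[of "\<lambda>v. x (_ # v)"] assms)
qed

text \<open>
  Since \<open>conc_inverse x\<close> has constant coefficient 1 as well, it has a right inverse of its own, and in
  a monoid an element with a left and a right inverse has equal ones.
\<close>

lemma conc_inverse_inverse:
  assumes "x [] = 1"
  shows "conc_inverse (conc_inverse x) = x"
proof -
  have "x = conc x (conc (conc_inverse x) (conc_inverse (conc_inverse x)))"
    by (simp add: conc_inverse_right)
  also have "\<dots> = conc (conc x (conc_inverse x)) (conc_inverse (conc_inverse x))"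
    by (simp only: conc_assoc)
  also have "\<dots> = conc_inverse (conc_inverse x)"
    by (simp add: conc_inverse_right assms)
  finally show ?thesis by simp
qed

lemma conc_inverse_left:
  assumes "x [] = 1"
  shows "conc (conc_inverse x) x = unit"
  using conc_inverse_right[of "conc_inverse x"] assms by (simp add: conc_inverse_inverse)

lemma conc_inverse_conc:
  assumes "x [] = 1" "y [] = 1"
  shows "conc_inverse (conc x y) = conc (conc_inverse y) (conc_inverse x)"
proof -
  have 1: "conc x y [] = 1" using assms by (simp add: conc_Nil)
  have "conc (conc (conc_inverse y) (conc_inverse x)) (conc x y) = conc (conc_inverse y) (conc (conc (conc_inverse x) x) y)"
    by (simp add: conc_assoc)
  then have *: "conc (conc (conc_inverse y) (conc_inverse x)) (conc x y) = unit"
    using assms by (simp add: conc_inverse_left)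
  have "conc (conc_inverse y) (conc_inverse x) = conc (conc (conc_inverse y) (conc_inverse x)) (conc (conc x y) (conc_inverse (conc x y)))"
    using 1 by (simp add: conc_inverse_right)
  also have "\<dots> = conc (conc (conc (conc_inverse y) (conc_inverse x)) (conc x y)) (conc_inverse (conc x y))"
    by (simp only: conc_assoc)
  finally show ?thesis by (simp add: *)
qed

lemma conc_inverse_cong:
  assumes "\<And>u. length u \<le> length w \<Longrightarrow> x u = x' u"
  shows "conc_inverse x w = conc_inverse x' w"
  using assms
proof (induction x w rule: conc_inverse.induct)
  case (2 x i w)
  then show ?case by (auto intro!: sum.cong)
qed simp

section \<open>The shuffle coproduct and group-like series\<close>

lemma coshuffle_single_left: "coshuffle x ([], v) = x v"
  by (simp add: coshuffle_dual pairing_def word_def)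

lemma coshuffle_single_right: "coshuffle x (u, []) = x u"
  by (simp add: coshuffle_dual shuffle_Nil pairing_def word_def)

lemma sum_words_Suc:
  fixes f :: "('d::finite) list \<Rightarrow> real"
  shows "(\<Sum>w | length w = Suc n. (case w of [] \<Rightarrow> 0 | k # w' \<Rightarrow> if k = i then f w' else 0)) =
    (\<Sum>w | length w = n. f w)"
proof -
  have fin: "finite {w :: 'd list. length w = m}" for m
    using finite_lists_length_eq[of "UNIV :: 'd set" m] by simp
  have "(\<Sum>w | length w = Suc n. (case w of [] \<Rightarrow> 0 | k # w' \<Rightarrow> if k = i then f w' else 0)) =
      (\<Sum>w\<in>Cons i ` {w. length w = n}. (case w of [] \<Rightarrow> 0 | k # w' \<Rightarrow> if k = i then f w' else 0))"
    by (rule sum.mono_neutral_right[OF fin]) (auto split: list.splits)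
  then show ?thesis by (simp add: sum.reindex)
qed

text \<open>
  The last clause of the recursion for the shuffle product, transposed. The cases with an empty
  word on one side are \<open>coshuffle_single_left\<close> and \<open>coshuffle_single_right\<close>.
\<close>

lemma coshuffle_Cons:
  "coshuffle x (i # u, j # v) =
     coshuffle (\<lambda>w. x (i # w)) (u, j # v) + coshuffle (\<lambda>w. x (j # w)) (i # u, v)"
proof -
  have "coshuffle x (i # u, j # v) =
      (\<Sum>w | length w = Suc (length u + length (j # v)).
         (case w of [] \<Rightarrow> 0 | k # w' \<Rightarrow> if k = i then x (i # w') * coshuffle_word w' (u, j # v) else 0)) +
      (\<Sum>w | length w = Suc (length (i # u) + length v).
         (case w of [] \<Rightarrow> 0 | k # w' \<Rightarrow> if k = j then x (j # w') * coshuffle_word w' (i # u, v) else 0))"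
    unfolding coshuffle_def prod.case coshuffle_word_eq
    by (simp add: sum.distrib[symmetric] conc_word)
      (rule sum.cong, auto simp: algebra_simps split: list.split)
  then show ?thesis
    by (simp add: sum_words_Suc coshuffle_def del: coshuffle_word.simps)
qed

lemma coshuffle_add: "coshuffle (\<lambda>w. x w + y w) q = coshuffle x q + coshuffle y q"
  by (cases q) (simp add: coshuffle_def distrib_right sum.distrib)

lemma coshuffle_scale: "coshuffle (\<lambda>w. c * x w) q = c * coshuffle x q"
  by (cases q) (simp add: coshuffle_def sum_distrib_left mult.assoc)

lemma coshuffle_cong:
  assumes "\<And>w. length w = length u + length v \<Longrightarrow> x w = y w"
  shows "coshuffle x (u, v) = coshuffle y (u, v)"
  using assms by (simp add: coshuffle_def)

lemma conc2_splits:
  "conc2 a b (u, v) = (\<Sum>(u1, u2)\<in>splits u. \<Sum>(v1, v2)\<in>splits v. a (u1, v1) * b (u2, v2))"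
  by (simp add: conc2_def splits_def)

text \<open>
  The coproduct is multiplicative because it is a recursion in left quotients by letters, and these
  act on a product by the twisted Leibniz rule \<open>conc_Cons\<close>. The induction is on the total length of
  the two words; when both begin with a letter, the four combinations of an empty or nonempty
  left factor match the terms produced by \<open>coshuffle_Cons\<close>.
\<close>

lemma coshuffle_conc: "coshuffle (conc x y) = conc2 (coshuffle x) (coshuffle y)"
proof
  fix q :: "'a list \<times> 'a list"
  have "coshuffle (conc x y) (u, v) = conc2 (coshuffle x) (coshuffle y) (u, v)" for u v
  proof (induction "length u + length v" arbitrary: u v x rule: less_induct)
    case less
    show ?case
    proof (cases "u = [] \<or> v = []")
      case True
      then show ?thesis
        by (elim disjE) (simp_all add: conc2_splits sum_splits_Nil coshuffle_single_left
          coshuffle_single_right conc_splits case_prod_unfold)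
    next
      case False
      then obtain i u' j v' where uv: "u = i # u'" "v = j # v'"
        by (meson list.exhaust)
      have IH: "coshuffle (conc x y) (u', v) = conc2 (coshuffle x) (coshuffle y) (u', v)"
        "coshuffle (conc x y) (u, v') = conc2 (coshuffle x) (coshuffle y) (u, v')" for x
        using uv by (auto intro!: less)
      have "coshuffle (conc x y) (u, v) =
          coshuffle (\<lambda>w. x [] * y (i # w) + conc (\<lambda>v. x (i # v)) y w) (u', v) +
          coshuffle (\<lambda>w. x [] * y (j # w) + conc (\<lambda>v. x (j # v)) y w) (u, v')"
        by (simp add: uv coshuffle_Cons conc_Cons)
      also have "\<dots> = x [] * coshuffle y (u, v) +
          conc2 (coshuffle (\<lambda>v. x (i # v))) (coshuffle y) (u', v) +
          conc2 (coshuffle (\<lambda>v. x (j # v))) (coshuffle y) (u, v')"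
        unfolding coshuffle_add coshuffle_scale IH by (simp add: uv coshuffle_Cons algebra_simps)
      also have "\<dots> = conc2 (coshuffle x) (coshuffle y) (u, v)"
        unfolding uv conc2_splits sum_splits_Cons
        by (simp add: coshuffle_Cons coshuffle_single_left coshuffle_single_right
            case_prod_unfold sum.distrib algebra_simps)
      finally show ?thesis .
    qed
  qed
  then show "coshuffle (conc x y) q = conc2 (coshuffle x) (coshuffle y) q" by (cases q) simp
qed

definition proper_splits2 :: "'d list \<Rightarrow> 'd list \<Rightarrow> (('d list \<times> 'd list) \<times> ('d list \<times> 'd list)) set"
  where "proper_splits2 u v = splits u \<times> splits v - {(([], u), ([], v)), ((u, []), (v, []))}"

lemma proper_splits2D:
  assumes "((u1, u2), (v1, v2)) \<in> proper_splits2 u v"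
  shows "length u1 + length v1 < length u + length v" "length u2 + length v2 < length u + length v"
    "length u1 + length u2 = length u" "length v1 + length v2 = length v"
  using assms by (auto simp: proper_splits2_def splits_def)

text \<open>
  The tensor-square version of \<open>conc_proper\<close>: the two extreme terms carry the full pair of words, all
  others have smaller total length on both sides.
\<close>

lemma conc2_proper:
  assumes "u @ v \<noteq> []"
  shows "conc2 a b (u, v) = a ([], []) * b (u, v) + a (u, v) * b ([], []) +
    (\<Sum>((u1, u2), (v1, v2))\<in>proper_splits2 u v. a (u1, v1) * b (u2, v2))"
proof -
  have "conc2 a b (u, v) = (\<Sum>((u1, u2), (v1, v2))\<in>splits u \<times> splits v. a (u1, v1) * b (u2, v2))"
    by (simp add: conc2_splits sum.cartesian_product case_prod_unfold)
  then show ?thesis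
    unfolding proper_splits2_def
    by (subst (asm) sum.subset_diff[of "{(([], u), ([], v)), ((u, []), (v, []))}"])
      (use assms in \<open>auto simp: splits_def finite_splits\<close>)
qed

lemma conc2_tensor: "conc2 (tensor x x') (tensor y y') = tensor (conc x y) (conc x' y')"
  by (rule ext) (auto simp: conc2_splits tensor_def conc_splits sum_product case_prod_unfold
      intro!: sum.cong)

text \<open>
  Group-likeness tested only on pairs of words whose concatenation lies in a set $W$. With all words
  it describes \<open>G\<close>, with the words of length at most $n$ it describes \<open>G_trunc n\<close>.
\<close>

definition group_like :: "('d::finite) list set \<Rightarrow> 'd series \<Rightarrow> bool"
  where "group_like W x \<longleftrightarrow> x [] = 1 \<and> (\<forall>u v. u @ v \<in> W \<longrightarrow> coshuffle x (u, v) = x u * x v)"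

text \<open>
  For such sets, membership of \<open>u @ v\<close> depends on the total length only and passes to all factors,
  which is all that the algebra of group-like series uses.
\<close>

definition level_set :: "'d list set \<Rightarrow> bool"
  where "level_set W \<longleftrightarrow> [] \<in> W \<and> (\<forall>w\<in>W. \<forall>v. length v \<le> length w \<longrightarrow> v \<in> W)"

lemma level_setD: "level_set W \<Longrightarrow> w \<in> W \<Longrightarrow> length v \<le> length w \<Longrightarrow> v \<in> W"
  by (auto simp: level_set_def)

lemma level_set_words_upto [simp]: "level_set (words_upto n)"
  and level_set_UNIV [simp]: "level_set UNIV"
  by (auto simp: level_set_def words_upto_def)

lemma group_like_cong:
  assumes "level_set W" "\<And>w. w \<in> W \<Longrightarrow> x w = y w" "group_like W x"
  shows "group_like W y"
proof -
  have "coshuffle x (u, v) = coshuffle y (u, v)" if "u @ v \<in> W" for u v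
    by (rule coshuffle_cong) (use that assms(2) level_setD[OF assms(1)] in auto)
  moreover have "u \<in> W" "v \<in> W" if "u @ v \<in> W" for u v
    using level_setD[OF assms(1) that] by auto
  moreover have "[] \<in> W" using assms(1) by (auto simp: level_set_def)
  ultimately show ?thesis using assms(2,3) unfolding group_like_def by metis
qed

lemma group_like_unit: "group_like W unit"
proof -
  have "coshuffle unit (u, v) = unit u * unit v" for u v :: "'a list"
  proof (cases u; cases v)
    fix i u' j v' assume "u = i # u'" "v = (j :: 'a) # v'"
    then show ?thesis by (simp add: coshuffle_Cons) (simp add: coshuffle_def)
  qed (simp_all add: coshuffle_single_left coshuffle_single_right)
  then show ?thesis by (simp add: group_like_def)
qed

lemma group_like_conc:
  assumes W: "level_set W" and x: "group_like W x" and y: "group_like W y"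
  shows "group_like W (conc x y)"
  unfolding group_like_def
proof (intro conjI allI impI)
  show "conc x y [] = 1" using x y by (simp add: conc_Nil group_like_def)
next
  fix u v assume uv: "u @ v \<in> W"
  have "coshuffle (conc x y) (u, v) = conc2 (coshuffle x) (coshuffle y) (u, v)"
    by (simp add: coshuffle_conc)
  also have "\<dots> = conc2 (tensor x x) (tensor y y) (u, v)"
    unfolding conc2_splits
  proof (intro sum.cong refl, clarify, intro sum.cong refl, clarify)
    fix u1 u2 v1 v2 assume "(u1, u2) \<in> splits u" "(v1, v2) \<in> splits v"
    then have "length (u1 @ v1) \<le> length (u @ v)" "length (u2 @ v2) \<le> length (u @ v)"
      by (auto simp: splits_def)
    then have "u1 @ v1 \<in> W" "u2 @ v2 \<in> W" using level_setD[OF W uv] by blast+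
    then show "coshuffle x (u1, v1) * coshuffle y (u2, v2) = tensor x x (u1, v1) * tensor y y (u2, v2)"
      using x y by (simp add: group_like_def tensor_def)
  qed
  finally show "coshuffle (conc x y) (u, v) = conc x y u * conc x y v"
    by (simp add: conc2_tensor) (simp add: tensor_def)
qed

text \<open>
  Let $x$ be group-like and $y$ its inverse. The coproduct of $y$ and $y \otimes y$ are both right
  inverses of $x \otimes x$, the former by multiplicativity of the coproduct. Comparing the two products
  at a pair of words, all terms but the leading one agree by induction on the total length.
\<close>

lemma group_like_inverse:
  assumes W: "level_set W" and x: "group_like W x"
  shows "group_like W (conc_inverse x)"
  unfolding group_like_def
proof (intro conjI allI impI)
  show "conc_inverse x [] = 1" by simp
next
  have x1: "x [] = 1" using x by (simp add: group_like_def)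
  let ?y = "conc_inverse x"
  fix u v assume "u @ v \<in> W"
  then show "coshuffle ?y (u, v) = ?y u * ?y v"
  proof (induction "length u + length v" arbitrary: u v rule: less_induct)
    case less
    show ?case
    proof (cases "u @ v = []")
      case True
      then show ?thesis by (simp add: coshuffle_single_left)
    next
      case False
      have eq: "coshuffle x (u1, v1) = tensor x x (u1, v1)"
        if "length u1 + length v1 \<le> length u + length v" for u1 v1
        using level_setD[OF W less(2), of "u1 @ v1"] that x by (simp add: group_like_def tensor_def)
      have IH: "coshuffle ?y (u2, v2) = tensor ?y ?y (u2, v2)"
        if "length u2 + length v2 < length u + length v" for u2 v2
        using level_setD[OF W less(2), of "u2 @ v2"] less(1)[OF that] that by (simp add: tensor_def)
      have "conc2 (coshuffle x) (coshuffle ?y) (u, v) = coshuffle unit (u, v)"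
        by (simp add: coshuffle_conc[symmetric] conc_inverse_right x1)
      also have "\<dots> = tensor unit unit (u, v)"
        using group_like_unit[of "UNIV :: 'a list set"] unfolding group_like_def tensor_def by simp
      also have "\<dots> = conc2 (tensor x x) (tensor ?y ?y) (u, v)"
        by (simp add: conc2_tensor conc_inverse_right x1)
      finally have "conc2 (coshuffle x) (coshuffle ?y) (u, v) = conc2 (tensor x x) (tensor ?y ?y) (u, v)" .
      moreover have "(\<Sum>((u1, u2), (v1, v2))\<in>proper_splits2 u v. coshuffle x (u1, v1) * coshuffle ?y (u2, v2)) =
          (\<Sum>((u1, u2), (v1, v2))\<in>proper_splits2 u v. tensor x x (u1, v1) * tensor ?y ?y (u2, v2))"
      proof (rule sum.cong[OF refl], clarify)
        fix u1 u2 v1 v2 assume "((u1, u2), (v1, v2)) \<in> proper_splits2 u v"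
        note d = proper_splits2D[OF this]
        show "coshuffle x (u1, v1) * coshuffle ?y (u2, v2) = tensor x x (u1, v1) * tensor ?y ?y (u2, v2)"
          using eq[of u1 v1] IH[of u2 v2] d by simp
      qed
      ultimately have "coshuffle ?y (u, v) = tensor ?y ?y (u, v)"
        using False by (simp add: conc2_proper eq coshuffle_single_left x1) (simp add: tensor_def x1)
      then show ?thesis by (simp add: tensor_def)
    qed
  qed
qed

section \<open>The truncated and the full group\<close>

lemma finite_words_upto: "finite (words_upto n :: ('d::finite) list set)"
  using finite_lists_length_le[of "UNIV :: 'd set" n] by (simp add: words_upto_def)

lemma trunc_space_iff:
  "(x :: ('d::finite) series) \<in> trunc_space n \<longleftrightarrow> (\<forall>w. length w > n \<longrightarrow> x w = 0)"
proof
  assume "\<forall>w. length w > n \<longrightarrow> x w = 0"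
  then have "{w. x w \<noteq> 0} \<subseteq> words_upto n" by (auto simp: words_upto_def not_less[symmetric])
  then show "x \<in> trunc_space n"
    using finite_subset[OF _ finite_words_upto] by (auto simp: free_space_def)
qed (auto simp: free_space_def words_upto_def)

lemma trunc_trunc_space: "trunc n (x :: ('d::finite) series) \<in> trunc_space n"
  by (simp add: trunc_space_iff trunc_def)

lemma trunc_eq_iff: "trunc n x = trunc n y \<longleftrightarrow> (\<forall>w. length w \<le> n \<longrightarrow> x w = y w)"
  by (auto simp: trunc_def fun_eq_iff)

lemma trunc_id: "(x :: ('d::finite) series) \<in> trunc_space n \<Longrightarrow> trunc n x = x"
  by (auto simp: trunc_space_iff trunc_def fun_eq_iff)

lemma trunc_unit [simp]: "trunc n unit = unit"
  by (auto simp: trunc_def unit_def word_def)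

lemma trunc_conc_trunc [simp]: "trunc n (conc (trunc n x) y) = trunc n (conc x y)"
  "trunc n (conc x (trunc n y)) = trunc n (conc x y)"
  unfolding trunc_eq_iff by (auto simp: trunc_def intro!: conc_cong)

text \<open>
  A nonzero series with multiplicative coefficients has constant coefficient 1: this coefficient is
  idempotent, and if it were 0 then all coefficients would vanish.
\<close>

lemma carrier_G: "carrier G = Collect (group_like UNIV)"
proof -
  have "g \<noteq> zero \<and> coshuffle g = tensor g g \<longleftrightarrow> group_like UNIV g" for g :: "'a series"
  proof
    assume g: "g \<noteq> zero \<and> coshuffle g = tensor g g"
    then have *: "coshuffle g (u, v) = g u * g v" for u v by (simp add: tensor_def)
    have "g [] \<noteq> 0"
    proof
      assume "g [] = 0"
      then have "g w = 0" for w using *[of "[]" w] by (simp add: coshuffle_single_left)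
      then show False using g by (auto simp: zero_def)
    qed
    then have "g [] = 1" using *[of "[]" "[]"] by (simp add: coshuffle_single_left)
    then show "group_like UNIV g" using * by (simp add: group_like_def)
  qed (auto simp: group_like_def tensor_def zero_def fun_eq_iff intro!: exI[of _ "[]"])
  then show ?thesis by (auto simp: G_def)
qed

lemma carrier_G_trunc: "carrier (G_trunc n) = {g \<in> trunc_space n. group_like (words_upto n) g}"
proof -
  have "g \<noteq> zero \<and> coshuffle g = trunc2 n (tensor g g) \<longleftrightarrow> group_like (words_upto n) g"
    if g: "g \<in> trunc_space n" for g :: "'a series"
  proof
    assume *: "g \<noteq> zero \<and> coshuffle g = trunc2 n (tensor g g)"
    then have **: "coshuffle g (u, v) = g u * g v" if "length u + length v \<le> n" for u v
      using that by (simp add: tensor_def trunc2_def)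
    have "g [] \<noteq> 0"
    proof
      assume "g [] = 0"
      then have "g w = 0" if "length w \<le> n" for w
        using **[of "[]" w] that by (simp add: coshuffle_single_left)
      then have "g w = 0" for w using g by (cases "length w \<le> n") (auto simp: trunc_space_iff)
      then show False using * by (auto simp: zero_def)
    qed
    then have "g [] = 1" using **[of "[]" "[]"] by (simp add: coshuffle_single_left)
    then show "group_like (words_upto n) g" using ** by (simp add: group_like_def words_upto_def)
  next
    assume *: "group_like (words_upto n) g"
    have "coshuffle g (u, v) = trunc2 n (tensor g g) (u, v)" for u v
    proof (cases "length u + length v \<le> n")
      case True
      then show ?thesis using * by (simp add: group_like_def words_upto_def trunc2_def tensor_def)
    next
      case False
      then show ?thesis using g
        by (auto simp: trunc2_def coshuffle_def trunc_space_iff intro!: sum.neutral)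
    qed
    moreover have "g \<noteq> zero" using * by (auto simp: group_like_def zero_def)
    ultimately show "g \<noteq> zero \<and> coshuffle g = trunc2 n (tensor g g)" by auto
  qed
  then show ?thesis by (auto simp: G_trunc_def)
qed

lemma group_like_trunc [simp]: "group_like (words_upto n) (trunc n x) \<longleftrightarrow> group_like (words_upto n) x"
proof -
  have "x w = trunc n x w" if "w \<in> words_upto n" for w
    using that by (simp add: trunc_def words_upto_def)
  then show ?thesis
    using group_like_cong[OF level_set_words_upto, of n] by metis
qed

lemma group_G: "group (G :: ('d::finite) series monoid)"
proof (rule groupI)
  fix x :: "'d series" assume "x \<in> carrier G"
  then show "\<exists>y\<in>carrier G. y \<otimes>\<^bsub>G\<^esub> x = \<one>\<^bsub>G\<^esub>"
    unfolding carrier_G by (intro bexI[of _ "conc_inverse x"]) (auto simp: group_like_inverse, simp add: G_def group_like_def conc_inverse_left)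
qed (unfold carrier_G, auto simp: group_like_unit group_like_conc conc_assoc G_def)

lemma group_G_trunc: "group (G_trunc n :: ('d::finite) series monoid)"
proof (rule groupI)
  fix x :: "'d series" assume "x \<in> carrier (G_trunc n)"
  then have x: "x \<in> trunc_space n" "group_like (words_upto n) x" "x [] = 1"
    by (auto simp: carrier_G_trunc group_like_def)
  show "\<exists>y\<in>carrier (G_trunc n). y \<otimes>\<^bsub>G_trunc n\<^esub> x = \<one>\<^bsub>G_trunc n\<^esub>"
    using x group_like_inverse[of "words_upto n" x]
    by (intro bexI[of _ "trunc n (conc_inverse x)"])
      (simp_all add: carrier_G_trunc trunc_trunc_space, simp add: G_trunc_def conc_trunc_def conc_inverse_left)
next
  fix x y z :: "'d series"
  show "x \<otimes>\<^bsub>G_trunc n\<^esub> y \<otimes>\<^bsub>G_trunc n\<^esub> z = x \<otimes>\<^bsub>G_trunc n\<^esub> (y \<otimes>\<^bsub>G_trunc n\<^esub> z)"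
    by (simp add: G_trunc_def conc_trunc_def conc_assoc)
next
  show "\<one>\<^bsub>G_trunc n\<^esub> \<in> carrier (G_trunc n :: 'd series monoid)"
    using trunc_trunc_space[of n unit] unfolding carrier_G_trunc
    by (simp add: group_like_unit) (simp add: G_trunc_def group_like_unit)
next
  fix x y :: "'d series" assume "x \<in> carrier (G_trunc n)" "y \<in> carrier (G_trunc n)"
  then show "x \<otimes>\<^bsub>G_trunc n\<^esub> y \<in> carrier (G_trunc n)"
    unfolding carrier_G_trunc
    by (simp add: G_trunc_def conc_trunc_def group_like_conc trunc_trunc_space)
next
  fix x :: "'d series" assume "x \<in> carrier (G_trunc n)"
  then show "\<one>\<^bsub>G_trunc n\<^esub> \<otimes>\<^bsub>G_trunc n\<^esub> x = x"
    unfolding carrier_G_trunc by (simp add: G_trunc_def conc_trunc_def trunc_id)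
qed

text \<open>
  The increment of a path, formed in the algebra of all series. It agrees with the increments in
  \<open>G\<close> and, after truncation, with those in \<open>G_trunc n\<close>, so that one notion serves both groups.
\<close>

definition inc :: "(real \<Rightarrow> 'd series) \<Rightarrow> real \<Rightarrow> real \<Rightarrow> 'd series"
  where "inc X s t = conc (conc_inverse (X s)) (X t)"

lemma increment_G:
  assumes "X s \<in> carrier G"
  shows "increment G X s t = inc X s t"
proof -
  have "inv\<^bsub>G\<^esub> (X s) = conc_inverse (X s)"
    using assms by (intro group.inv_equality[OF group_G])
     (auto simp: carrier_G group_like_inverse, simp add: G_def group_like_def conc_inverse_left)
  then show ?thesis by (simp add: increment_def inc_def) (simp add: G_def)
qed

lemma increment_G_trunc:
  assumes "X s \<in> carrier (G_trunc n)"
  shows "increment (G_trunc n) X s t = trunc n (inc X s t)"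
proof -
  have "X s [] = 1" using assms by (auto simp: carrier_G_trunc group_like_def)
  then have "inv\<^bsub>G_trunc n\<^esub> (X s) = trunc n (conc_inverse (X s))"
    using assms by (intro group.inv_equality[OF group_G_trunc])
     (auto simp: carrier_G_trunc group_like_inverse trunc_trunc_space,
       simp add: G_trunc_def conc_trunc_def conc_inverse_left)
  then show ?thesis by (simp add: increment_def inc_def) (simp add: G_trunc_def conc_trunc_def)
qed

section \<open>Homogeneous bounds and the norm of the truncated groups\<close>

text \<open>
  Bounds that are uniform over a set $P$ of parameters are expressed by the Landau symbol for the
  principal filter of $P$, which makes the calculus of Landau symbols available for them.
\<close>

lemma bigo_principal:
  fixes f g :: "'p \<Rightarrow> real"
  shows "f \<in> O[principal P](g) \<longleftrightarrow> (\<exists>c. \<forall>p\<in>P. \<bar>f p\<bar> \<le> c * \<bar>g p\<bar>)"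
proof
  assume "f \<in> O[principal P](g)"
  then obtain c where "\<forall>p\<in>P. \<bar>f p\<bar> \<le> c * \<bar>g p\<bar>"
    by (elim landau_o.bigE) (auto simp: eventually_principal)
  then show "\<exists>c. \<forall>p\<in>P. \<bar>f p\<bar> \<le> c * \<bar>g p\<bar>" ..
next
  assume "\<exists>c. \<forall>p\<in>P. \<bar>f p\<bar> \<le> c * \<bar>g p\<bar>"
  then obtain c where "\<forall>p\<in>P. \<bar>f p\<bar> \<le> c * \<bar>g p\<bar>" ..
  then show "f \<in> O[principal P](g)"
    by (intro bigoI[of _ c]) (simp add: eventually_principal)
qed

lemma bigo_principal_pow:
  fixes f h :: "'p \<Rightarrow> real"
  assumes "\<forall>p\<in>P. 0 \<le> h p"
  shows "f \<in> O[principal P](\<lambda>p. h p ^ m) \<longleftrightarrow> (\<exists>c. \<forall>p\<in>P. \<bar>f p\<bar> \<le> c * h p ^ m)"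
  unfolding bigo_principal using assms by simp

lemma bigo_mult_pow:
  fixes f g h :: "'p \<Rightarrow> real"
  assumes "f \<in> O[F](\<lambda>p. h p ^ a)" "g \<in> O[F](\<lambda>p. h p ^ b)" "a + b = m"
  shows "(\<lambda>p. f p * g p) \<in> O[F](\<lambda>p. h p ^ m)"
  using landau_o.big.mult[OF assms(1,2)] assms(3) by (simp add: power_add[symmetric])

text \<open>
  A family of series is homogeneously bounded if its coefficient at $w$ is $O(h^{|w|})$. Lengths add
  up under concatenation, so these bounds pass to products, and by induction to inverses.
\<close>

lemma bigo_conc:
  fixes h :: "'p \<Rightarrow> real"
  assumes "\<And>v. length v \<le> length w \<Longrightarrow> (\<lambda>p. x p v) \<in> O[F](\<lambda>p. h p ^ length v)"
    and "\<And>v. length v \<le> length w \<Longrightarrow> (\<lambda>p. y p v) \<in> O[F](\<lambda>p. h p ^ length v)"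
  shows "(\<lambda>p. conc (x p) (y p) w) \<in> O[F](\<lambda>p. h p ^ length w)"
  unfolding conc_splits case_prod_unfold
proof (intro big_sum_in_bigo)
  fix q assume "q \<in> splits w"
  then show "(\<lambda>p. x p (fst q) * y p (snd q)) \<in> O[F](\<lambda>p. h p ^ length w)"
    by (intro bigo_mult_pow[OF assms]) (auto simp: splits_def)
qed

lemma bigo_conc_inverse:
  fixes h :: "'p \<Rightarrow> real"
  assumes "\<And>v. length v \<le> length w \<Longrightarrow> (\<lambda>p. x p v) \<in> O[F](\<lambda>p. h p ^ length v)"
  shows "(\<lambda>p. conc_inverse (x p) w) \<in> O[F](\<lambda>p. h p ^ length w)"
  using assms
proof (induction "length w" arbitrary: w rule: less_induct)
  case less
  show ?case
  proof (cases w)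
    case (Cons i v)
    have "(\<lambda>p. \<Sum>k\<le>length v. x p (i # take k v) * conc_inverse (x p) (drop k v)) \<in> O[F](\<lambda>p. h p ^ length w)"
    proof (intro big_sum_in_bigo)
      fix k assume "k \<in> {..length v}"
      then show "(\<lambda>p. x p (i # take k v) * conc_inverse (x p) (drop k v)) \<in> O[F](\<lambda>p. h p ^ length w)"
        using Cons by (intro bigo_mult_pow[OF less(2) less(1)] less(2)) auto
    qed
    then show ?thesis using Cons by simp
  qed simp
qed

text \<open>
  Powers in the algebra of all series; the powers in \<open>T_trunc n\<close> are their truncations.
\<close>

primrec conc_power :: "'d series \<Rightarrow> nat \<Rightarrow> 'd series" where
  "conc_power u 0 = unit"
| "conc_power u (Suc k) = conc (conc_power u k) u"

lemma T_trunc_pow: "trunc n u [^]\<^bsub>T_trunc n\<^esub> k = trunc n (conc_power u k)" for k :: nat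
proof (induction k)
  case 0
  show ?case by (simp add: nat_pow_def) (simp add: T_trunc_def)
next
  case (Suc k)
  have "trunc n u [^]\<^bsub>T_trunc n\<^esub> Suc k = conc_trunc n (trunc n u [^]\<^bsub>T_trunc n\<^esub> k) (trunc n u)"
    by (simp add: nat_pow_def) (simp add: T_trunc_def)
  then show ?case by (simp add: Suc conc_trunc_def)
qed

lemma conc_power_vanishes:
  assumes "u [] = 0" "length w < k"
  shows "conc_power u k w = 0"
  using assms(2)
proof (induction k arbitrary: w)
  case (Suc k)
  have "conc_power u k a * u b = 0" if "(a, b) \<in> splits w" for a b
    using that Suc assms(1) by (cases b) (auto simp: splits_def)
  then show ?case by (auto simp: conc_splits intro!: sum.neutral)
qed simp

text \<open>
  Without constant coefficient, the $k$-th power of a series vanishes on words shorter than $k$. This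
  turns the logarithmic series at $w$ into a finite sum, whose linear term is the coefficient of $g$.
\<close>

lemma log_trunc_finite:
  fixes g :: "('d::finite) series"
  assumes "g [] = 1" "length w \<le> n" "w \<noteq> []"
  shows "log_trunc n (trunc n g) w =
    g w + (\<Sum>k=1..<length w. (- 1) ^ k / real (Suc k) * conc_power (\<lambda>v. g v - unit v) (Suc k) w)"
proof -
  let ?u = "\<lambda>v. g v - unit v"
  let ?f = "\<lambda>k. (- 1) ^ k / real (Suc k) * conc_power ?u (Suc k) w"
  have "(\<lambda>v. trunc n g v - unit v) = trunc n ?u"
    by (auto simp: trunc_def unit_def word_def)
  then have "log_trunc n (trunc n g) w = (\<Sum>k. ?f k)"
    unfolding log_trunc_def \<open>_ = trunc n ?u\<close> T_trunc_pow using assms(2) by (simp only: trunc_def if_True)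
  also have "\<dots> = (\<Sum>k<length w. ?f k)"
  proof (rule suminf_finite)
    fix k assume "k \<notin> {..<length w}"
    then show "?f k = 0" using assms(1) by (simp add: conc_power_vanishes del: conc_power.simps)
  qed simp
  also have "\<dots> = ?f 0 + (\<Sum>k=1..<length w. ?f k)"
    using assms(3) by (simp add: lessThan_atLeast0 sum.atLeast_Suc_lessThan del: conc_power.simps)
  also have "?f 0 = g w"
    using assms(3) by (cases w) simp_all
  finally show ?thesis .
qed

text \<open>
  A power of exponent at least 2 of a series without constant coefficient is, at the word $w$, a sum over
  proper factorisations of $w$. Hence it is controlled by coefficients at strictly shorter words.
\<close>

lemma bigo_log_remainder:
  fixes g :: "'p \<Rightarrow> ('d::finite) series" and h :: "'p \<Rightarrow> real"
  assumes g1: "\<And>p. p \<in> P \<Longrightarrow> g p [] = 1" and w: "length w \<le> n" "w \<noteq> []"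
    and lower: "\<And>v. length v < length w \<Longrightarrow> (\<lambda>p. g p v) \<in> O[principal P](\<lambda>p. h p ^ length v)"
  shows "(\<lambda>p. log_trunc n (trunc n (g p)) w - g p w) \<in> O[principal P](\<lambda>p. h p ^ length w)"
proof -
  define u where "u p = (\<lambda>v. g p v - unit v)" for p
  have u0: "u p [] = 0" if "p \<in> P" for p using g1[OF that] by (simp add: u_def)
  have unit: "(\<lambda>p. unit v) \<in> O[principal P](\<lambda>p. h p ^ length v)" for v :: "'d list"
    by (cases v) simp_all
  have u: "(\<lambda>p. u p v) \<in> O[principal P](\<lambda>p. h p ^ length v)" if "length v < length w" for v
    unfolding u_def by (intro sum_in_bigo lower unit that)
  have pow: "(\<lambda>p. conc_power (u p) k v) \<in> O[principal P](\<lambda>p. h p ^ length v)" if "length v < length w" for k v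
    using that by (induction k arbitrary: v) (auto intro!: bigo_conc u unit)
  have "(\<lambda>p. conc_power (u p) (Suc (Suc k)) w) \<in> O[principal P](\<lambda>p. h p ^ length w)" for k
  proof -
    have "(\<lambda>p. \<Sum>(a, b)\<in>proper_splits w. conc_power (u p) (Suc k) a * u p b) \<in> O[principal P](\<lambda>p. h p ^ length w)"
      unfolding case_prod_unfold
    proof (intro big_sum_in_bigo)
      fix q assume "q \<in> proper_splits w"
      then show "(\<lambda>p. conc_power (u p) (Suc k) (fst q) * u p (snd q)) \<in> O[principal P](\<lambda>p. h p ^ length w)"
        using proper_splitsD[of "fst q" "snd q" w] by (intro bigo_mult_pow[OF pow u]) auto
    qed
    also have "?this \<longleftrightarrow> ?thesis"
    proof (rule landau_o.big.in_cong)
      show "\<forall>\<^sub>F p in principal P. (\<Sum>(a, b)\<in>proper_splits w. conc_power (u p) (Suc k) a * u p b) =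
          conc_power (u p) (Suc (Suc k)) w"
        using conc_proper[OF w(2)] by (simp add: eventually_principal u0 conc_Nil)
    qed
    finally show ?thesis .
  qed
  then have "(\<lambda>p. \<Sum>k=1..<length w. (- 1) ^ k / real (Suc k) * conc_power (u p) (Suc k) w)
      \<in> O[principal P](\<lambda>p. h p ^ length w)"
  proof (intro big_sum_in_bigo)
    fix k assume "k \<in> {1..<length w}"
    then obtain j where "k = Suc j" by (cases k) auto
    with \<open>\<And>k. (\<lambda>p. conc_power (u p) (Suc (Suc k)) w) \<in> _\<close>[of j]
    show "(\<lambda>p. (- 1) ^ k / real (Suc k) * conc_power (u p) (Suc k) w) \<in> O[principal P](\<lambda>p. h p ^ length w)"
      by (simp del: conc_power.simps)
  qed
  also have "?this \<longleftrightarrow> ?thesis"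
  proof (rule landau_o.big.in_cong)
    show "\<forall>\<^sub>F p in principal P. (\<Sum>k=1..<length w. (- 1) ^ k / real (Suc k) * conc_power (u p) (Suc k) w) =
        log_trunc n (trunc n (g p)) w - g p w"
      using log_trunc_finite[of "g _", OF _ w] g1
      by (simp add: eventually_principal u_def del: conc_power.simps)
  qed
  finally show ?thesis .
qed

text \<open>
  By induction on the length: at each word the difference of the two coefficients is already controlled
  by the shorter words.
\<close>

lemma bigo_log_iff:
  fixes g :: "'p \<Rightarrow> ('d::finite) series" and h :: "'p \<Rightarrow> real"
  assumes g1: "\<And>p. p \<in> P \<Longrightarrow> g p [] = 1"
  shows "(\<forall>w. w \<noteq> [] \<and> length w \<le> n \<longrightarrow>
      (\<lambda>p. log_trunc n (trunc n (g p)) w) \<in> O[principal P](\<lambda>p. h p ^ length w)) \<longleftrightarrow>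
    (\<forall>w. length w \<le> n \<longrightarrow> (\<lambda>p. g p w) \<in> O[principal P](\<lambda>p. h p ^ length w))"
    (is "?L \<longleftrightarrow> ?R")
proof
  assume L: ?L
  have "(\<lambda>p. g p w) \<in> O[principal P](\<lambda>p. h p ^ length w)" if "length w \<le> n" for w
    using that
  proof (induction "length w" arbitrary: w rule: less_induct)
    case less
    show ?case
    proof (cases "w = []")
      case True
      have "(\<lambda>p. g p []) \<in> O[principal P](\<lambda>p. 1)"
        using g1 by (intro bigoI[of _ 1]) (auto simp: eventually_principal)
      then show ?thesis using True by simp
    next
      case False
      have "(\<lambda>p. log_trunc n (trunc n (g p)) w - g p w) \<in> O[principal P](\<lambda>p. h p ^ length w)"
        using less False by (intro bigo_log_remainder g1) auto
      moreover have "(\<lambda>p. log_trunc n (trunc n (g p)) w) \<in> O[principal P](\<lambda>p. h p ^ length w)"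
        using L False less(2) by blast
      ultimately show ?thesis using sum_in_bigo(2) by fastforce
    qed
  qed
  then show ?R by blast
next
  assume R: ?R
  show ?L
  proof (intro allI impI, elim conjE)
    fix w :: "'d list" assume w: "w \<noteq> []" "length w \<le> n"
    have "(\<lambda>p. log_trunc n (trunc n (g p)) w - g p w) \<in> O[principal P](\<lambda>p. h p ^ length w)"
      using R w by (intro bigo_log_remainder g1) auto
    moreover have "(\<lambda>p. g p w) \<in> O[principal P](\<lambda>p. h p ^ length w)"
      using R w by blast
    ultimately show "(\<lambda>p. log_trunc n (trunc n (g p)) w) \<in> O[principal P](\<lambda>p. h p ^ length w)"
      using sum_in_bigo(1) by fastforce
  qed
qed

lemma tnorm_proj:
  fixes x :: "('d::finite) series"
  shows "tnorm (proj m x) = sqrt (\<Sum>w | length w = m. (x w)\<^sup>2)"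
proof -
  have fin: "finite {w :: 'd list. length w = m}"
    using finite_lists_length_eq[of "UNIV :: 'd set" m] by simp
  have "pairing (proj m x) (proj m x) = (\<Sum>w | length w = m. proj m x w * proj m x w)"
    unfolding pairing_def by (rule sum.mono_neutral_left[OF fin]) (auto simp: proj_def)
  then show ?thesis by (simp add: tnorm_def proj_def power2_eq_square)
qed

lemma tnorm_nonneg: "0 \<le> tnorm (proj m (x :: ('d::finite) series))"
  by (simp add: tnorm_proj sum_nonneg)

lemma abs_le_tnorm_proj: "\<bar>x w\<bar> \<le> tnorm (proj (length w) (x :: ('d::finite) series))"
proof -
  have fin: "finite {v :: 'd list. length v = length w}"
    using finite_lists_length_eq[of "UNIV :: 'd set" "length w"] by simp
  have "(x w)\<^sup>2 \<le> (\<Sum>v | length v = length w. (x v)\<^sup>2)"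
    using member_le_sum[OF _ _ fin, of w "\<lambda>v. (x v)\<^sup>2"] by simp
  from real_sqrt_le_mono[OF this] show ?thesis by (simp add: tnorm_proj)
qed

lemma bigo_tnorm_proj_iff:
  fixes x :: "'p \<Rightarrow> ('d::finite) series" and h :: "'p \<Rightarrow> real"
  assumes h: "\<forall>p\<in>P. 0 \<le> h p"
  shows "(\<exists>c. \<forall>p\<in>P. tnorm (proj m (x p)) \<le> c * h p ^ m) \<longleftrightarrow>
    (\<forall>w. length w = m \<longrightarrow> (\<lambda>p. x p w) \<in> O[principal P](\<lambda>p. h p ^ m))" (is "?L \<longleftrightarrow> ?R")
proof
  assume ?L
  then obtain c where "\<forall>p\<in>P. tnorm (proj m (x p)) \<le> c * h p ^ m" ..
  then have c: "tnorm (proj m (x p)) \<le> c * h p ^ m" if "p \<in> P" for p using that by blast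
  have "\<bar>x p w\<bar> \<le> c * h p ^ m" if "length w = m" "p \<in> P" for w p
    using abs_le_tnorm_proj[of "x p" w] c[OF that(2)] that(1) by simp
  then show ?R
    using bigo_principal_pow[OF h] by blast
next
  assume R: ?R
  have "(\<lambda>p. \<Sum>w | length w = m. (x p w)\<^sup>2) \<in> O[principal P](\<lambda>p. h p ^ (2 * m))"
    using R by (intro big_sum_in_bigo) (auto simp: power2_eq_square intro: bigo_mult_pow)
  from iffD1[OF bigo_principal_pow[OF h] this]
  obtain c where c: "\<bar>\<Sum>w | length w = m. (x p w)\<^sup>2\<bar> \<le> c * h p ^ (2 * m)" if "p \<in> P" for p
    by blast
  have "tnorm (proj m (x p)) \<le> sqrt c * h p ^ m" if "p \<in> P" for p
  proof -
    have "tnorm (proj m (x p)) \<le> sqrt (c * (h p ^ m)\<^sup>2)"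
      unfolding tnorm_proj using c[OF that] by (intro real_sqrt_le_mono) (simp add: power_mult mult.commute)
    then show ?thesis using h that by (simp add: real_sqrt_mult)
  qed
  then show ?L by blast
qed

text \<open>
  The $m$-th summand of the homogeneous norm is the $m$-th root of the size of the logarithm in degree
  $m$. A bound linear in $h$ on the sum is thus a bound of order $h^m$ on the coefficients of degree
  $m$ of the logarithm, and then of $g$.
\<close>

lemma G_norm_bound_iff:
  fixes g :: "'p \<Rightarrow> ('d::finite) series" and h :: "'p \<Rightarrow> real"
  assumes g1: "\<And>p. p \<in> P \<Longrightarrow> g p [] = 1" and h: "\<And>p. p \<in> P \<Longrightarrow> 0 \<le> h p"
  shows "(\<exists>c. \<forall>p\<in>P. G_norm n (trunc n (g p)) \<le> c * h p) \<longleftrightarrow>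
    (\<forall>w. length w \<le> n \<longrightarrow> (\<lambda>p. g p w) \<in> O[principal P](\<lambda>p. h p ^ length w))"
proof -
  define N where "N m p = tnorm (proj m (log_trunc n (trunc n (g p))))" for m p
  have N0: "0 \<le> N m p" for m p by (simp add: N_def tnorm_nonneg)
  have G: "G_norm n (trunc n (g p)) = (\<Sum>m=1..n. N m p powr (1 / real m))" for p
    by (simp add: G_norm_def N_def)
  have "(\<exists>c. \<forall>p\<in>P. G_norm n (trunc n (g p)) \<le> c * h p) \<longleftrightarrow>
      (\<forall>m\<in>{1..n}. \<exists>c. \<forall>p\<in>P. N m p \<le> c * h p ^ m)" (is "?L \<longleftrightarrow> ?R")
  proof
    assume ?L
    then obtain c where c: "G_norm n (trunc n (g p)) \<le> c * h p" if "p \<in> P" for p by blast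
    have "N m p \<le> c ^ m * h p ^ m" if "m \<in> {1..n}" "p \<in> P" for m p
    proof -
      have "N m p powr (1 / real m) \<le> G_norm n (trunc n (g p))"
        unfolding G using that by (intro member_le_sum) auto
      then have "N m p powr (1 / real m) \<le> c * h p" using c[OF that(2)] by linarith
      then have "(N m p powr (1 / real m)) ^ m \<le> (c * h p) ^ m" by (intro power_mono) auto
      moreover have "(N m p powr (1 / real m)) ^ m = N m p"
        using that N0[of m p] by (cases "N m p = 0") (auto simp: powr_power)
      ultimately show ?thesis by (simp add: power_mult_distrib)
    qed
    then show ?R by blast
  next
    assume ?R
    then obtain c where c: "N m p \<le> c m * h p ^ m" if "m \<in> {1..n}" "p \<in> P" for m p by metis
    have "N m p powr (1 / real m) \<le> \<bar>c m\<bar> powr (1 / real m) * h p" if m: "m \<in> {1..n}" and p: "p \<in> P" for m p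
    proof -
      have "N m p \<le> \<bar>c m\<bar> * h p ^ m"
        using c[OF that] h[OF p] by (meson abs_ge_self mult_right_mono order.trans zero_le_power)
      then have "N m p powr (1 / real m) \<le> (\<bar>c m\<bar> * h p ^ m) powr (1 / real m)"
        using N0 by (intro powr_mono2) auto
      also have "\<dots> = \<bar>c m\<bar> powr (1 / real m) * (h p ^ m) powr (1 / real m)"
        using h[OF p] by (simp add: powr_mult)
      also have "(h p ^ m) powr (1 / real m) = h p"
        using h[OF p] m by (cases "h p = 0") (auto simp: powr_realpow[symmetric] powr_powr)
      finally show ?thesis .
    qed
    then have "G_norm n (trunc n (g p)) \<le> (\<Sum>m=1..n. \<bar>c m\<bar> powr (1 / real m)) * h p" if "p \<in> P" for p
      unfolding G sum_distrib_right using that by (intro sum_mono) blast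
    then show ?L by blast
  qed
  also have "\<dots> \<longleftrightarrow> (\<forall>w. w \<noteq> [] \<and> length w \<le> n \<longrightarrow>
      (\<lambda>p. log_trunc n (trunc n (g p)) w) \<in> O[principal P](\<lambda>p. h p ^ length w))"
  proof -
    have "(\<exists>c. \<forall>p\<in>P. N m p \<le> c * h p ^ m) \<longleftrightarrow> (\<forall>w. length w = m \<longrightarrow>
        (\<lambda>p. log_trunc n (trunc n (g p)) w) \<in> O[principal P](\<lambda>p. h p ^ m))" for m
      unfolding N_def by (rule bigo_tnorm_proj_iff) (use h in blast)
    then show ?thesis by (auto simp: Suc_le_eq)
  qed
  also have "\<dots> \<longleftrightarrow> (\<forall>w. length w \<le> n \<longrightarrow> (\<lambda>p. g p w) \<in> O[principal P](\<lambda>p. h p ^ length w))"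
    by (rule bigo_log_iff) (rule g1)
  finally show ?thesis .
qed

section \<open>Sewing almost additive functions of intervals\<close>

text \<open>
  The total error when each of $2^n$ equal subintervals contributes its length to the power
  $\theta$. It decays geometrically for $\theta > 1$, which drives all limits below.
\<close>

lemma dyadic_mesh_sum:
  assumes "0 \<le> (L :: real)"
  shows "2 ^ n * (L / 2 ^ n) powr \<theta> = L powr \<theta> * (2 powr (1 - \<theta>)) ^ n"
proof -
  have "(2 powr (1 - \<theta>)) ^ n = 2 powr (real n - real n * \<theta>)"
    by (simp add: powr_power algebra_simps)
  also have "\<dots> = 2 ^ n / (2 ^ n) powr \<theta>"
    by (simp add: powr_diff powr_powr[symmetric] powr_realpow)
  finally show ?thesis using assms by (simp add: powr_divide field_simps)
qed

lemma halving_ratio: "1 < \<theta> \<Longrightarrow> 0 \<le> 2 powr (1 - \<theta>) \<and> 2 powr (1 - \<theta>) < (1 :: real)"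
  using powr_less_cancel_iff[of 2 "1 - \<theta>" 0] by simp

lemma tendsto_dyadic_mesh:
  assumes "1 < \<theta>"
  shows "(\<lambda>n. c * (2 powr (1 - \<theta>)) ^ n) \<longlonglongrightarrow> (0 :: real)"
  using LIMSEQ_realpow_zero[of "2 powr (1 - \<theta>)"] halving_ratio[OF assms]
  by (auto intro!: tendsto_mult_right_zero)

text \<open>
  Telescoping over $2^n$ equal steps bounds the increment by $2^n \cdot C (t/2^n)^{\theta}$, which
  tends to 0.
\<close>

lemma hoelder_gt_one_constant:
  fixes f :: "real \<Rightarrow> real"
  assumes \<theta>: "1 < \<theta>"
    and f: "\<And>s t. 0 \<le> s \<Longrightarrow> s \<le> t \<Longrightarrow> t \<le> T \<Longrightarrow> \<bar>f t - f s\<bar> \<le> C * (t - s) powr \<theta>"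
    and t: "0 \<le> t" "t \<le> T"
  shows "f t = f 0"
proof -
  have "\<bar>f t - f 0\<bar> \<le> C * t powr \<theta> * (2 powr (1 - \<theta>)) ^ n" for n
  proof -
    define a where "a k = real k * (t / 2 ^ n)" for k
    have step: "a (Suc k) - a k = t / 2 ^ n" and le_Suc: "a k \<le> a (Suc k)" for k
      using t by (simp_all add: a_def field_simps)
    have ge: "0 \<le> a k" for k using t by (simp add: a_def)
    have le: "a k \<le> t" if "k \<le> 2 ^ n" for k
    proof -
      have "real k \<le> 2 ^ n" using that by (metis of_nat_le_iff of_nat_numeral of_nat_power)
      then show ?thesis using t mult_right_mono[of "real k" "2 ^ n" t] by (simp add: a_def field_simps)
    qed
    have "(\<Sum>k<2 ^ n. f (a (Suc k)) - f (a k)) = f (a (2 ^ n)) - f (a 0)"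
      by (rule sum_lessThan_telescope)
    then have "\<bar>f t - f 0\<bar> = \<bar>\<Sum>k<2 ^ n. f (a (Suc k)) - f (a k)\<bar>"
      by (simp add: a_def)
    also have "\<dots> \<le> (\<Sum>k<(2 :: nat) ^ n. C * (t / 2 ^ n) powr \<theta>)"
    proof (intro order.trans[OF sum_abs] sum_mono)
      fix k :: nat assume "k \<in> {..<2 ^ n}"
      then have "a (Suc k) \<le> t" by (intro le) auto
      then show "\<bar>f (a (Suc k)) - f (a k)\<bar> \<le> C * (t / 2 ^ n) powr \<theta>"
        using f[of "a k" "a (Suc k)"] ge[of k] step[of k] le_Suc[of k] t by simp
    qed
    also have "\<dots> = C * (2 ^ n * (t / 2 ^ n) powr \<theta>)" by simp
    finally show ?thesis by (simp add: dyadic_mesh_sum t mult.assoc)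
  qed
  then have "\<bar>f t - f 0\<bar> \<le> 0"
    by (intro tendsto_lowerbound[OF tendsto_dyadic_mesh[OF \<theta>]] always_eventually) auto
  then show ?thesis by simp
qed

text \<open>
  A function $\Xi$ of intervals whose additivity defect is of order greater than 1 in the length of the interval.
  Sewing produces the additive function of intervals closest to it.
\<close>

locale almost_additive =
  fixes \<Xi> :: "real \<Rightarrow> real \<Rightarrow> real" and C \<theta> T :: real
  assumes \<theta>: "1 < \<theta>" and C: "0 \<le> C" and T: "0 < T"
    and defect: "\<And>s u t. 0 \<le> s \<Longrightarrow> s \<le> u \<Longrightarrow> u \<le> t \<Longrightarrow> t \<le> T \<Longrightarrow>
      \<bar>\<Xi> s t - \<Xi> s u - \<Xi> u t\<bar> \<le> C * (t - s) powr \<theta>"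
begin

text \<open>
  The fixed point of the estimate $K \mapsto 2^{1-\theta} K + 2C$, which arises when an interval is
  bisected: two halves, each with the bound $K (L/2)^{\theta}$, and two defects of size at most
  $C L^{\theta}$.
\<close>

definition K :: real where "K = 2 * C / (1 - 2 powr (1 - \<theta>))"

lemma K_nonneg: "0 \<le> K"
  using halving_ratio[OF \<theta>] C by (simp add: K_def)

lemma K_eq: "K * 2 powr (1 - \<theta>) + 2 * C = K"
proof -
  have "K * (1 - 2 powr (1 - \<theta>)) = 2 * C"
    using halving_ratio[OF \<theta>] \<theta> by (simp add: K_def)
  then show ?thesis by (simp add: algebra_simps)
qed

lemma diagonal: "0 \<le> s \<Longrightarrow> s \<le> T \<Longrightarrow> \<Xi> s s = 0"
  using defect[of s s s] by simp

lemma defect':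
  assumes "0 \<le> s" "s \<le> u" "u \<le> t" "t \<le> T" "t - s \<le> L"
  shows "\<bar>\<Xi> s t - \<Xi> s u - \<Xi> u t\<bar> \<le> C * L powr \<theta>"
proof -
  have "(t - s) powr \<theta> \<le> L powr \<theta>" using assms \<theta> by (intro powr_mono2) auto
  then show ?thesis using defect[OF assms(1-4)] mult_left_mono[OF _ C] by fastforce
qed

text \<open>
  Riemann sums of $\Xi$ stay within $K L^{\theta}$ of its value on the whole interval of length $L$,
  uniformly in the partition. The interval of the partition that contains the midpoint is split
  off; the parts to its left and right have at most half the length, so that the induction
  hypothesis gains the factor $2^{-\theta}$ on each of them.
\<close>

lemma partition_sum:
  assumes "mono x" "\<And>k. 0 \<le> x k" "\<And>k. x k \<le> T" "i \<le> j"
  shows "\<bar>(\<Sum>k=i..<j. \<Xi> (x k) (x (Suc k))) - \<Xi> (x i) (x j)\<bar> \<le> K * (x j - x i) powr \<theta>"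
  using assms(4)
proof (induction "j - i" arbitrary: i j rule: less_induct)
  case less
  let ?S = "\<lambda>i j. \<Sum>k=i..<j. \<Xi> (x k) (x (Suc k))"
  have x_mono: "x a \<le> x b" if "a \<le> b" for a b using assms(1) that by (rule monoD)
  show ?case
  proof (cases "i = j")
    case True
    then show ?thesis using diagonal assms(2,3) by simp
  next
    case False
    define L where "L = x j - x i"
    \<comment> \<open>The index interval from \<open>l - 1\<close> to \<open>l\<close> is the one that contains the midpoint.\<close>
    define l where "l = (LEAST l. i < l \<and> (x i + x j) / 2 \<le> x l)"
    have j: "i < j \<and> (x i + x j) / 2 \<le> x j" using x_mono[OF less(2)] False less(2) by auto
    have l: "i < l" "(x i + x j) / 2 \<le> x l" "l \<le> j"
      using LeastI[of "\<lambda>l. i < l \<and> (x i + x j) / 2 \<le> x l", OF j]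
        Least_le[of "\<lambda>l. i < l \<and> (x i + x j) / 2 \<le> x l", OF j] by (auto simp: l_def)
    then obtain k where k: "l = Suc k" "i \<le> k" "k < j" by (cases l) auto
    have xk: "x k \<le> (x i + x j) / 2"
    proof (cases "k = i")
      case True
      then show ?thesis using x_mono[OF less(2)] by simp
    next
      case False
      moreover have "k < (LEAST l. i < l \<and> (x i + x j) / 2 \<le> x l)" using k(1) by (simp add: l_def)
      ultimately show ?thesis using not_less_Least[of k "\<lambda>l. i < l \<and> (x i + x j) / 2 \<le> x l"] k(2)
        by linarith
    qed
    have L0: "0 \<le> L" using x_mono[OF less(2)] by (simp add: L_def)
    have split: "?S i j = ?S i k + \<Xi> (x k) (x (Suc k)) + ?S (Suc k) j"
      using k by (simp add: sum.atLeastLessThan_concat[of i "Suc k" j, symmetric] flip: sum.atLeastLessThan_Suc)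
    have half: "K * (b - a) powr \<theta> \<le> K * (L / 2) powr \<theta>" if "a \<le> b" "b - a \<le> L / 2" for a b
      using that \<theta> K_nonneg by (intro mult_left_mono powr_mono2) auto
    have IH1: "\<bar>?S i k - \<Xi> (x i) (x k)\<bar> \<le> K * (L / 2) powr \<theta>"
    proof (rule order.trans[OF less(1)[of k i] half])
      show "x k - x i \<le> L / 2" using xk by (simp add: L_def field_simps)
    qed (use k x_mono in auto)
    have IH2: "\<bar>?S (Suc k) j - \<Xi> (x (Suc k)) (x j)\<bar> \<le> K * (L / 2) powr \<theta>"
    proof (rule order.trans[OF less(1)[of j "Suc k"] half])
      show "x j - x (Suc k) \<le> L / 2" using l(2) k(1) by (simp add: L_def field_simps)
    qed (use k x_mono in auto)
    have d: "\<bar>\<Xi> (x i) (x j) - \<Xi> (x i) (x k) - \<Xi> (x k) (x j)\<bar> \<le> C * L powr \<theta>"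
      "\<bar>\<Xi> (x k) (x j) - \<Xi> (x k) (x (Suc k)) - \<Xi> (x (Suc k)) (x j)\<bar> \<le> C * L powr \<theta>"
      using k by (auto intro!: defect' x_mono assms simp: L_def)
    have "2 * (K * (L / 2) powr \<theta>) = K * 2 powr (1 - \<theta>) * L powr \<theta>"
      using L0 by (simp add: powr_divide powr_diff field_simps)
    then have "2 * (K * (L / 2) powr \<theta>) + 2 * (C * L powr \<theta>) = (K * 2 powr (1 - \<theta>) + 2 * C) * L powr \<theta>"
      by (simp add: algebra_simps)
    then have "2 * (K * (L / 2) powr \<theta>) + 2 * (C * L powr \<theta>) = K * L powr \<theta>"
      by (simp add: K_eq)
    then show ?thesis using IH1 IH2 d unfolding split L_def[symmetric] by linarith
  qed
qed

text \<open>
  The dyadic partition of $[0, T]$ of generation $n$. For the Riemann sums up to time $t$ its nodes are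
  capped at $t$, so that the same partition serves all times and intervals beyond $t$ degenerate to
  a point, where $\Xi$ vanishes.
\<close>

definition node :: "nat \<Rightarrow> nat \<Rightarrow> real" where "node n k = real k * (T / 2 ^ n)"

definition riemann :: "nat \<Rightarrow> real \<Rightarrow> real"
  where "riemann n t = (\<Sum>k<2 ^ n. \<Xi> (min t (node n k)) (min t (node n (Suc k))))"

lemma node_nonneg: "0 \<le> node n k" and node_Suc: "node n (Suc k) = node n k + T / 2 ^ n"
  and node_zero: "node n 0 = 0" and node_last: "node n (2 ^ n) = T"
  and node_refine: "node (Suc n) (2 * k) = node n k"
  using T by (simp_all add: node_def field_simps)

lemma node_mono: "mono (node n)"
  using T by (auto simp: node_def mono_def intro!: divide_right_mono mult_right_mono)

lemma riemann_refine:
  assumes "0 \<le> t" "t \<le> T"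
  shows "\<bar>riemann (Suc n) t - riemann n t\<bar> \<le> C * T powr \<theta> * (2 powr (1 - \<theta>)) ^ n"
proof -
  define m where "m k = min t (node (Suc n) k)" for k
  have m_even: "m (2 * k) = min t (node n k)" "m (Suc (Suc (2 * k))) = min t (node n (Suc k))" for k
    using node_refine[of n k] node_refine[of n "Suc k"] by (simp_all add: m_def)
  have m: "0 \<le> m k" "m k \<le> m (Suc k)" "m k \<le> T" for k
    using assms node_nonneg node_mono by (auto simp: m_def mono_def min_le_iff_disj)
  have step: "m (Suc (Suc (2 * k))) - m (2 * k) \<le> T / 2 ^ n" for k
  proof -
    have "node (Suc n) (Suc (Suc (2 * k))) = node (Suc n) (2 * k) + T / 2 ^ n"
      by (simp add: node_def field_simps)
    moreover have "0 < T / 2 ^ n" using T by simp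
    ultimately show ?thesis unfolding m_def by linarith
  qed
  have "riemann (Suc n) t = (\<Sum>k<2 ^ n. \<Sum>i=k*2..<k*2+2. \<Xi> (m i) (m (Suc i)))"
    using sum.nat_group[of "\<lambda>i. \<Xi> (m i) (m (Suc i))" 2 "2 ^ n"]
    by (simp add: riemann_def m_def mult.commute)
  also have "\<dots> = (\<Sum>k<2 ^ n. \<Xi> (m (2 * k)) (m (Suc (2 * k))) + \<Xi> (m (Suc (2 * k))) (m (Suc (Suc (2 * k)))))"
    by (simp add: mult.commute numeral_2_eq_2)
  finally have "riemann n t - riemann (Suc n) t = (\<Sum>k<2 ^ n. \<Xi> (m (2 * k)) (m (Suc (Suc (2 * k)))) -
      \<Xi> (m (2 * k)) (m (Suc (2 * k))) - \<Xi> (m (Suc (2 * k))) (m (Suc (Suc (2 * k)))))"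
    by (simp add: riemann_def m_even sum_subtractf sum.distrib)
  then have "\<bar>riemann (Suc n) t - riemann n t\<bar> \<le> (\<Sum>k<(2::nat) ^ n. C * (T / 2 ^ n) powr \<theta>)"
    by (subst abs_minus_commute, simp only:) (intro order.trans[OF sum_abs] sum_mono defect' m step)
  also have "\<dots> = C * (2 ^ n * (T / 2 ^ n) powr \<theta>)" by simp
  finally show ?thesis using T by (simp add: dyadic_mesh_sum mult.assoc)
qed

lemma riemann_convergent:
  assumes "0 \<le> t" "t \<le> T"
  shows "convergent (\<lambda>n. riemann n t)"
proof -
  have "summable (\<lambda>n. C * T powr \<theta> * (2 powr (1 - \<theta>)) ^ n)"
    using halving_ratio[OF \<theta>] by (intro summable_mult summable_geometric) auto
  then have "summable (\<lambda>n. riemann (Suc n) t - riemann n t)"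
    by (rule summable_comparison_test') (use riemann_refine[OF assms] in auto)
  from tendsto_add[OF summable_LIMSEQ[OF this] tendsto_const[of "riemann 0 t"]] show ?thesis
    unfolding sum_lessThan_telescope[of "\<lambda>n. riemann n t"] by (auto intro: convergentI)
qed

text \<open>
  The Riemann sums at $s$ and $t$ differ by the Riemann sum over $[s, t]$, up to at most one interval of
  the partition, the one cut by $s$. For every interval the mismatch is a defect of that interval (or zero), and
  counting it $2^n$ times still leaves an error that tends to 0.
\<close>

lemma riemann_increment:
  assumes st: "0 \<le> s" "s \<le> t" "t \<le> T"
  shows "\<bar>riemann n t - riemann n s - \<Xi> s t\<bar> \<le> K * (t - s) powr \<theta> + C * T powr \<theta> * (2 powr (1 - \<theta>)) ^ n"
proof -
  \<comment> \<open>The dyadic partition clamped to $[s, t]$.\<close>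
  define c where "c k = max s (min t (node n k))" for k
  have "mono c"
    unfolding c_def by (intro monoI max.mono min.mono monoD[OF node_mono] order_refl)
  then have "\<bar>(\<Sum>k=0..<2^n. \<Xi> (c k) (c (Suc k))) - \<Xi> (c 0) (c (2^n))\<bar> \<le> K * (c (2^n) - c 0) powr \<theta>"
    by (rule partition_sum) (use st in \<open>auto simp: c_def\<close>)
  moreover have "c 0 = s" "c (2 ^ n) = t" using st by (simp_all add: c_def node_zero node_last)
  ultimately have 1: "\<bar>(\<Sum>k<2^n. \<Xi> (c k) (c (Suc k))) - \<Xi> s t\<bar> \<le> K * (t - s) powr \<theta>"
    by (simp add: atLeast0LessThan)
  let ?d = "\<lambda>k. \<Xi> (min t (node n k)) (min t (node n (Suc k))) -
      \<Xi> (min s (node n k)) (min s (node n (Suc k))) - \<Xi> (c k) (c (Suc k))"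
  have d: "\<bar>?d k\<bar> \<le> C * (T / 2 ^ n) powr \<theta>" for k
  proof -
    have le: "node n k \<le> node n (Suc k)" using node_mono[of n] by (simp add: mono_def)
    have nn: "0 \<le> C * (T / 2 ^ n) powr \<theta>" using C by simp
    \<comment> \<open>Only in the last case does \<open>s\<close> cut the interval, leaving a genuine defect.\<close>
    consider "s \<le> node n k" | "node n (Suc k) \<le> s" | "node n k < s" "s < node n (Suc k)" by linarith
    then show ?thesis
    proof cases
      case 1
      then show ?thesis using st le nn diagonal[of s] by (simp add: c_def min_absorb1 max_absorb2)
    next
      case 2
      then show ?thesis using st le nn diagonal[of s] by (simp add: c_def min_absorb2 max_absorb1)
    next
      case 3
      then have "?d k = \<Xi> (node n k) (min t (node n (Suc k))) - \<Xi> (node n k) s - \<Xi> s (min t (node n (Suc k)))"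
        using st by (simp add: c_def min_absorb2 min_absorb1 max_absorb1 max_absorb2)
      then show ?thesis using 3 st node_nonneg[of n k] node_Suc[of n k]
        by (auto intro!: defect')
    qed
  qed
  have "riemann n t - riemann n s - (\<Sum>k<2^n. \<Xi> (c k) (c (Suc k))) = (\<Sum>k<2^n. ?d k)"
    by (simp add: riemann_def sum_subtractf)
  then have "\<bar>riemann n t - riemann n s - (\<Sum>k<2^n. \<Xi> (c k) (c (Suc k)))\<bar> \<le>
      (\<Sum>k<(2::nat)^n. C * (T / 2 ^ n) powr \<theta>)"
    by (simp only:) (intro order.trans[OF sum_abs] sum_mono d)
  also have "\<dots> = C * (2 ^ n * (T / 2 ^ n) powr \<theta>)" by simp
  also have "\<dots> = C * T powr \<theta> * (2 powr (1 - \<theta>)) ^ n" using T by (simp add: dyadic_mesh_sum)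
  finally show ?thesis using 1 by linarith
qed

text \<open>
  The limit of the Riemann sums, shifted to vanish at 0.
\<close>

lemma sewing:
  obtains F where "F 0 = (0 :: real)"
    "\<And>s t. 0 \<le> s \<Longrightarrow> s \<le> t \<Longrightarrow> t \<le> T \<Longrightarrow> \<bar>F t - F s - \<Xi> s t\<bar> \<le> K * (t - s) powr \<theta>"
proof -
  define F where "F t = lim (\<lambda>n. riemann n t)" for t
  have F: "(\<lambda>n. riemann n t) \<longlonglongrightarrow> F t" if "0 \<le> t" "t \<le> T" for t
    using riemann_convergent[OF that] by (simp add: F_def convergent_LIMSEQ_iff)
  have "\<bar>(F t - F 0) - (F s - F 0) - \<Xi> s t\<bar> \<le> K * (t - s) powr \<theta>" if st: "0 \<le> s" "s \<le> t" "t \<le> T" for s t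
  proof -
    have "(\<lambda>n. \<bar>riemann n t - riemann n s - \<Xi> s t\<bar>) \<longlonglongrightarrow> \<bar>F t - F s - \<Xi> s t\<bar>"
      using st by (intro tendsto_intros F) auto
    moreover have "(\<lambda>n. K * (t - s) powr \<theta> + C * T powr \<theta> * (2 powr (1 - \<theta>)) ^ n) \<longlonglongrightarrow> K * (t - s) powr \<theta> + 0"
      by (intro tendsto_intros tendsto_dyadic_mesh \<theta>)
    ultimately have "\<bar>F t - F s - \<Xi> s t\<bar> \<le> K * (t - s) powr \<theta> + 0"
      by (rule LIMSEQ_le) (use riemann_increment[OF st] in auto)
    then show ?thesis by simp
  qed
  then show thesis by (intro that[of "\<lambda>t. F t - F 0"]) auto
qed

end

section \<open>Increments of group-like paths and their regularity\<close>

lemma inc_Nil: "X s [] = 1 \<Longrightarrow> X t [] = 1 \<Longrightarrow> inc X s t [] = 1"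
  by (simp add: inc_def conc_Nil)

lemma inc_same: "X t [] = 1 \<Longrightarrow> inc X t t = unit"
  by (simp add: inc_def conc_inverse_left)

lemma inc_chen:
  assumes "X u [] = 1"
  shows "conc (inc X s u) (inc X u t) = inc X s t"
proof -
  have "conc (inc X s u) (inc X u t) = conc (conc_inverse (X s)) (conc (conc (X u) (conc_inverse (X u))) (X t))"
    by (simp only: inc_def conc_assoc)
  then show ?thesis by (simp add: conc_inverse_right assms inc_def)
qed

lemma inc_swap:
  assumes "X s [] = 1" "X t [] = 1"
  shows "inc X t s = conc_inverse (inc X s t)"
  using assms by (simp add: inc_def conc_inverse_conc conc_inverse_inverse)

lemma conc_inc:
  assumes "X s [] = 1"
  shows "conc (X s) (inc X s t) = X t"
  using assms by (simp add: inc_def conc_inverse_right flip: conc_assoc)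

lemma group_like_inc:
  assumes "level_set W" "group_like W (X s)" "group_like W (X t)"
  shows "group_like W (inc X s t)"
  using assms by (simp add: inc_def group_like_conc group_like_inverse)

lemma inc_cong:
  assumes "\<And>v. length v \<le> length w \<Longrightarrow> X s v = Y s v" "\<And>v. length v \<le> length w \<Longrightarrow> X t v = Y t v"
  shows "inc X s t w = inc Y s t w"
  unfolding inc_def by (intro conc_cong conc_inverse_cong assms) auto

text \<open>
  Two paths that agree on words shorter than $w$ have increments whose difference at $w$ is additive:
  in the equation $\mathbf{X}_t = \mathbf{X}_s \mathbf{X}_{st}$ at $w$, the proper factorisations contribute the same to both.
  This is the source of both existence and uniqueness of extensions.
\<close>

lemma inc_change_top:
  assumes "w \<noteq> []" and lower: "\<And>v r. length v < length w \<Longrightarrow> r \<in> {s, t} \<Longrightarrow> X r v = Y r v"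
    and one: "Y s [] = 1" "Y t [] = 1"
  shows "inc X s t w = inc Y s t w + (X t w - Y t w) - (X s w - Y s w)"
proof -
  have one': "X s [] = 1" "X t [] = 1" using lower[of "[]"] assms(1) one by auto
  have "X t w = inc X s t w + X s w + (\<Sum>(u, v)\<in>proper_splits w. X s u * inc X s t v)"
    using conc_proper[OF assms(1), of "X s" "inc X s t"] one' by (simp add: conc_inc inc_Nil)
  moreover have "Y t w = inc Y s t w + Y s w + (\<Sum>(u, v)\<in>proper_splits w. Y s u * inc Y s t v)"
    using conc_proper[OF assms(1), of "Y s" "inc Y s t"] one by (simp add: conc_inc inc_Nil)
  moreover have "(\<Sum>(u, v)\<in>proper_splits w. X s u * inc X s t v) =
      (\<Sum>(u, v)\<in>proper_splits w. Y s u * inc Y s t v)"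
    by (intro sum.cong refl, clarify, intro arg_cong2[of _ _ _ _ "(*)"] inc_cong lower)
      (auto dest: proper_splitsD)
  ultimately show ?thesis by simp
qed

text \<open>
  On the diagonal the gauge is 0, and its power with the exponent $|w|$ is then the coefficient of
  the unit at $w$, also for the empty word. The bounds may therefore be stated for all pairs of times. The
  expression \<open>0 powr 0 = 0\<close> does not have this property.
\<close>

definition gauge :: "real \<Rightarrow> real \<times> real \<Rightarrow> real"
  where "gauge \<gamma> p = \<bar>snd p - fst p\<bar> powr \<gamma>"

abbreviation graded_hoelder ::
    "real \<Rightarrow> (real \<times> real) set \<Rightarrow> (real \<Rightarrow> 'd series) \<Rightarrow> 'd list \<Rightarrow> bool"
  where "graded_hoelder \<gamma> P X w \<equiv>
    (\<lambda>p. inc X (fst p) (snd p) w) \<in> O[principal P](\<lambda>p. gauge \<gamma> p ^ length w)"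

lemma gauge_nonneg [simp]: "0 \<le> gauge \<gamma> p" by (simp add: gauge_def)

lemma gauge_same [simp]: "gauge \<gamma> (t, t) = 0" by (simp add: gauge_def)

lemma gauge_power:
  assumes "0 < m"
  shows "gauge \<gamma> (s, t) ^ m = \<bar>t - s\<bar> powr (\<gamma> * real m)"
  using assms by (cases "s = t") (simp_all add: gauge_def powr_power mult.commute)

lemma graded_hoelder_iff:
  "graded_hoelder \<gamma> P X w \<longleftrightarrow> (\<exists>c. \<forall>(s, t)\<in>P. \<bar>inc X s t w\<bar> \<le> c * gauge \<gamma> (s, t) ^ length w)"
  by (subst bigo_principal_pow) (auto simp: case_prod_unfold)

definition ordered_pairs :: "real \<Rightarrow> (real \<times> real) set"
  where "ordered_pairs T = {(s, t). 0 \<le> s \<and> s < t \<and> t \<le> T}"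

text \<open>
  Reversing time inverts the increment, and inverses inherit homogeneous bounds.
\<close>

lemma graded_hoelder_ordered_pairs:
  assumes one: "\<forall>t\<in>{0..T}. X t [] = 1"
    and X: "\<And>v. length v \<le> length w \<Longrightarrow> graded_hoelder \<gamma> (ordered_pairs T) X v"
  shows "graded_hoelder \<gamma> ({0..T} \<times> {0..T}) X w"
proof -
  let ?Q = "{(s, t). 0 \<le> t \<and> t < s \<and> s \<le> T}" and ?E = "{(s, t). s = t \<and> 0 \<le> s \<and> s \<le> T}"
  have "(\<lambda>p. conc_inverse (inc X (snd p) (fst p)) w) \<in> O[principal ?Q](\<lambda>p. gauge \<gamma> p ^ length w)"
  proof (intro bigo_conc_inverse)
    fix v :: "'a list" assume "length v \<le> length w"
    from X[OF this] obtain c where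
      "\<forall>(s, t)\<in>ordered_pairs T. \<bar>inc X s t v\<bar> \<le> c * gauge \<gamma> (s, t) ^ length v"
      unfolding graded_hoelder_iff ..
    then have "\<forall>p\<in>?Q. \<bar>inc X (snd p) (fst p) v\<bar> \<le> c * gauge \<gamma> p ^ length v"
      by (auto simp: ordered_pairs_def gauge_def abs_minus_commute)
    then show "(\<lambda>p. inc X (snd p) (fst p) v) \<in> O[principal ?Q](\<lambda>p. gauge \<gamma> p ^ length v)"
      by (subst bigo_principal_pow) auto
  qed
  also have "?this \<longleftrightarrow> graded_hoelder \<gamma> ?Q X w"
  proof (rule landau_o.big.in_cong)
    show "\<forall>\<^sub>F p in principal ?Q. conc_inverse (inc X (snd p) (fst p)) w = inc X (fst p) (snd p) w"
      using one by (auto simp: eventually_principal intro!: fun_cong[OF inc_swap, symmetric])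
  qed
  finally have Q: "graded_hoelder \<gamma> ?Q X w" .
  have E: "graded_hoelder \<gamma> ?E X w"
    unfolding graded_hoelder_iff using one
    by (intro exI[of _ 1]) (cases w, auto simp: inc_same)
  have "{0..T} \<times> {0..T} = ordered_pairs T \<union> (?Q \<union> ?E)"
    by (auto simp: ordered_pairs_def)
  then show ?thesis
    using landau_o.big.sup[OF X[OF order_refl] landau_o.big.sup[OF Q E]] by simp
qed

text \<open>
  The common core of the four definitions: being group-like, starting at the unit, and satisfying the
  graded Hoelder condition, each tested on the words in $W$ only.
\<close>

definition rough :: "('d::finite) list set \<Rightarrow> real \<Rightarrow> real \<Rightarrow> (real \<Rightarrow> 'd series) \<Rightarrow> bool"
  where "rough W \<gamma> T X \<longleftrightarrow> (\<forall>t\<in>{0..T}. group_like W (X t)) \<and> (\<forall>w\<in>W. X 0 w = unit w) \<and>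
    (\<forall>w\<in>W. graded_hoelder \<gamma> ({0..T} \<times> {0..T}) X w)"

lemma rough_one: "rough W \<gamma> T X \<Longrightarrow> t \<in> {0..T} \<Longrightarrow> X t [] = 1"
  by (simp add: rough_def group_like_def)

lemma rough_cong:
  assumes "level_set W" "0 \<le> T" "\<And>t w. t \<in> {0..T} \<Longrightarrow> w \<in> W \<Longrightarrow> X t w = Y t w" "rough W \<gamma> T X"
  shows "rough W \<gamma> T Y"
proof -
  have "inc X s t w = inc Y s t w" if "s \<in> {0..T}" "t \<in> {0..T}" "w \<in> W" for s t w
    by (intro inc_cong assms(3) that level_setD[OF assms(1) that(3)])
  then have "graded_hoelder \<gamma> ({0..T} \<times> {0..T}) X w = graded_hoelder \<gamma> ({0..T} \<times> {0..T}) Y w" if "w \<in> W" for w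
    using that by (intro landau_o.big.in_cong) (auto simp: eventually_principal)
  moreover have "group_like W (Y t)" if "t \<in> {0..T}" for t
    using group_like_cong[OF assms(1) assms(3)[OF that]] assms(4) that by (simp add: rough_def)
  ultimately show ?thesis using assms by (simp add: rough_def)
qed

lemma rough_UNIV_iff: "rough UNIV \<gamma> T X \<longleftrightarrow> (\<forall>n. rough (words_upto n) \<gamma> T X)"
proof -
  have "group_like UNIV g \<longleftrightarrow> (\<forall>n. group_like (words_upto n) g)" for g :: "'a series"
    by (auto simp: group_like_def words_upto_def)
  moreover have "(\<forall>w. P w) \<longleftrightarrow> (\<forall>n. \<forall>w\<in>words_upto n. P w)" for P :: "'a list \<Rightarrow> bool"
    by (auto simp: words_upto_def)
  ultimately show ?thesis unfolding rough_def by auto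
qed

lemma bdd_above_quotient_iff:
  fixes f h :: "real \<Rightarrow> real \<Rightarrow> real"
  assumes "\<And>s t. Q s t \<Longrightarrow> 0 < h s t"
  shows "bdd_above {f s t / h s t | s t. Q s t} \<longleftrightarrow> (\<exists>c. \<forall>s t. Q s t \<longrightarrow> f s t \<le> c * h s t)"
proof -
  have "f s t / h s t \<le> c \<longleftrightarrow> f s t \<le> c * h s t" if "Q s t" for s t c
    using assms[OF that] by (simp add: pos_divide_le_eq)
  then show ?thesis unfolding bdd_above_def by (auto 0 4)
qed

lemma G_norm_increment_iff:
  fixes X :: "real \<Rightarrow> ('d::finite) series"
  assumes one: "\<forall>t\<in>{0..T}. X t [] = 1"
  shows "bdd_above {G_norm n (trunc n (inc X s t)) / \<bar>t - s\<bar> powr \<gamma> | s t.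
      s \<in> {0..T} \<and> t \<in> {0..T} \<and> s < t} \<longleftrightarrow>
    (\<forall>w\<in>words_upto n. graded_hoelder \<gamma> ({0..T} \<times> {0..T}) X w)"
proof -
  have "bdd_above {G_norm n (trunc n (inc X s t)) / \<bar>t - s\<bar> powr \<gamma> | s t.
      s \<in> {0..T} \<and> t \<in> {0..T} \<and> s < t} \<longleftrightarrow>
      (\<exists>c. \<forall>p\<in>ordered_pairs T. G_norm n (trunc n (inc X (fst p) (snd p))) \<le> c * gauge \<gamma> p)"
    by (subst bdd_above_quotient_iff, simp) (intro ex_cong1, auto simp: ordered_pairs_def gauge_def)
  also have "\<dots> \<longleftrightarrow> (\<forall>w. length w \<le> n \<longrightarrow> graded_hoelder \<gamma> (ordered_pairs T) X w)"
    using one by (intro G_norm_bound_iff) (auto simp: ordered_pairs_def intro!: inc_Nil)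
  also have "\<dots> \<longleftrightarrow> (\<forall>w\<in>words_upto n. graded_hoelder \<gamma> ({0..T} \<times> {0..T}) X w)"
  proof
    assume *: "\<forall>w. length w \<le> n \<longrightarrow> graded_hoelder \<gamma> (ordered_pairs T) X w"
    show "\<forall>w\<in>words_upto n. graded_hoelder \<gamma> ({0..T} \<times> {0..T}) X w"
    proof
      fix w :: "'d list" assume "w \<in> words_upto n"
      then show "graded_hoelder \<gamma> ({0..T} \<times> {0..T}) X w"
        using * by (intro graded_hoelder_ordered_pairs one) (auto simp: words_upto_def)
    qed
  next
    have sub: "principal (ordered_pairs T) \<le> principal ({0..T} \<times> {0..T})"
      by (auto simp: ordered_pairs_def)
    assume "\<forall>w\<in>words_upto n. graded_hoelder \<gamma> ({0..T} \<times> {0..T}) X w"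
    then show "\<forall>w. length w \<le> n \<longrightarrow> graded_hoelder \<gamma> (ordered_pairs T) X w"
      using landau_o.big.filter_mono[OF sub] by (auto simp: words_upto_def)
  qed
  finally show ?thesis .
qed

lemma R_iff:
  fixes X :: "real \<Rightarrow> ('d::finite) series"
  assumes "0 < T"
  shows "X \<in> R \<gamma> T \<longleftrightarrow> X \<in> extensional {0..T} \<and> (\<forall>t\<in>{0..T}. X t \<in> trunc_space (level \<gamma>)) \<and>
    rough (words_upto (level \<gamma>)) \<gamma> T X"
proof -
  define n where "n = level \<gamma>"
  have "X 0 = unit \<longleftrightarrow> (\<forall>w\<in>words_upto n. X 0 w = unit w)" if "X 0 \<in> trunc_space n"
    using trunc_eq_iff[of n "X 0" unit] trunc_id[OF that] by (simp add: words_upto_def)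
  moreover have "bdd_above {G_norm n (increment (G_trunc n) X s t) / \<bar>t - s\<bar> powr \<gamma> | s t.
      s \<in> {0..T} \<and> t \<in> {0..T} \<and> s < t} \<longleftrightarrow> (\<forall>w\<in>words_upto n. graded_hoelder \<gamma> ({0..T} \<times> {0..T}) X w)"
    if X: "\<forall>t\<in>{0..T}. X t \<in> carrier (G_trunc n)"
  proof -
    have "{G_norm n (increment (G_trunc n) X s t) / \<bar>t - s\<bar> powr \<gamma> | s t. s \<in> {0..T} \<and> t \<in> {0..T} \<and> s < t}
       = {G_norm n (trunc n (inc X s t)) / \<bar>t - s\<bar> powr \<gamma> | s t. s \<in> {0..T} \<and> t \<in> {0..T} \<and> s < t}"
      by (intro Collect_cong ex_cong1) (auto simp: increment_G_trunc X)
    moreover have "\<forall>t\<in>{0..T}. X t [] = 1" using X by (simp add: carrier_G_trunc group_like_def)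
    ultimately show ?thesis by (simp only: G_norm_increment_iff)
  qed
  moreover have "0 \<in> {0..T}" using assms by simp
  ultimately show ?thesis
    unfolding R_def rough_def n_def[symmetric]
    by (auto simp: PiE_iff carrier_G_trunc)
qed

lemma R_bar_iff:
  fixes X :: "real \<Rightarrow> ('d::finite) series"
  assumes "0 < T"
  shows "X \<in> R_bar \<gamma> T \<longleftrightarrow> X \<in> extensional {0..T} \<and> rough UNIV \<gamma> T X"
proof -
  have "bdd_above {G_norm n (trunc n (increment G X s t)) / \<bar>t - s\<bar> powr \<gamma> | s t.
      s \<in> {0..T} \<and> t \<in> {0..T} \<and> s < t} \<longleftrightarrow> (\<forall>w\<in>words_upto n. graded_hoelder \<gamma> ({0..T} \<times> {0..T}) X w)"
    if X: "\<forall>t\<in>{0..T}. X t \<in> carrier G" for n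
  proof -
    have "{G_norm n (trunc n (increment G X s t)) / \<bar>t - s\<bar> powr \<gamma> | s t. s \<in> {0..T} \<and> t \<in> {0..T} \<and> s < t}
       = {G_norm n (trunc n (inc X s t)) / \<bar>t - s\<bar> powr \<gamma> | s t. s \<in> {0..T} \<and> t \<in> {0..T} \<and> s < t}"
      by (intro Collect_cong ex_cong1) (auto simp: increment_G X)
    moreover have "\<forall>t\<in>{0..T}. X t [] = 1" using X by (simp add: carrier_G group_like_def)
    ultimately show ?thesis by (simp only: G_norm_increment_iff)
  qed
  moreover have "w \<in> words_upto (length w)" for w :: "'d list"
    by (simp add: words_upto_def)
  ultimately show ?thesis
    unfolding R_bar_def rough_def by (auto simp: PiE_iff carrier_G simp del: atLeastAtMost_iff) blast
qed

section \<open>Extending and comparing rough paths one level at a time\<close>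

lemma bigo_squareD:
  assumes "f \<in> O[principal ({0..T} \<times> {0..T})](\<lambda>p. gauge \<gamma> p ^ m)"
  shows "\<exists>c. \<forall>s\<in>{0..T}. \<forall>t\<in>{0..T}. \<bar>f (s, t)\<bar> \<le> c * gauge \<gamma> (s, t) ^ m"
  using assms by (subst (asm) bigo_principal_pow) auto

text \<open>
  By Chen's relation the defect at $w$ is the sum over the proper factorisations of $w$ of products of
  coefficients at shorter words, and the lengths of the two factors add up to $|w|$.
\<close>

lemma increment_defect_bound:
  assumes one: "\<forall>t\<in>{0..T}. X t [] = 1"
    and X: "\<And>v. length v < length w \<Longrightarrow> graded_hoelder \<gamma> ({0..T} \<times> {0..T}) X v"
    and \<gamma>: "0 < \<gamma>" and w: "w \<noteq> []"
  shows "\<exists>C\<ge>0. \<forall>s u t. 0 \<le> s \<and> s \<le> u \<and> u \<le> t \<and> t \<le> T \<longrightarrow>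
    \<bar>inc X s t w - inc X s u w - inc X u t w\<bar> \<le> C * (t - s) powr (\<gamma> * real (length w))"
proof -
  have "\<forall>v. \<exists>c. length v < length w \<longrightarrow>
      (\<forall>(s, t)\<in>{0..T} \<times> {0..T}. \<bar>inc X s t v\<bar> \<le> c * gauge \<gamma> (s, t) ^ length v)"
    using X unfolding graded_hoelder_iff by blast
  from choice[OF this] obtain c where c: "\<bar>inc X s t v\<bar> \<le> c v * gauge \<gamma> (s, t) ^ length v"
    if "length v < length w" "s \<in> {0..T}" "t \<in> {0..T}" for v s t
    by fast
  define C where "C = (\<Sum>(a, b)\<in>proper_splits w. \<bar>c a\<bar> * \<bar>c b\<bar>)"
  have "\<bar>inc X s t w - inc X s u w - inc X u t w\<bar> \<le> C * (t - s) powr (\<gamma> * real (length w))"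
    if st: "0 \<le> s" "s \<le> u" "u \<le> t" "t \<le> T" for s u t
  proof -
    have mem: "s \<in> {0..T}" "u \<in> {0..T}" "t \<in> {0..T}" using st by auto
    have b: "\<bar>inc X s' t' v\<bar> \<le> \<bar>c v\<bar> * gauge \<gamma> (s, t) ^ length v"
      if v: "length v < length w" and "s' \<in> {s, u}" "t' \<in> {u, t}" "s' \<le> t'" "s \<le> s'" "t' \<le> t" for s' t' v
    proof -
      have "gauge \<gamma> (s', t') \<le> gauge \<gamma> (s, t)"
        using that \<gamma> by (auto simp: gauge_def intro!: powr_mono2)
      then have "\<bar>c v\<bar> * gauge \<gamma> (s', t') ^ length v \<le> \<bar>c v\<bar> * gauge \<gamma> (s, t) ^ length v"
        by (intro mult_left_mono power_mono) auto
      moreover have "c v * gauge \<gamma> (s', t') ^ length v \<le> \<bar>c v\<bar> * gauge \<gamma> (s', t') ^ length v"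
        by (intro mult_right_mono) auto
      moreover have "s' \<in> {0..T}" "t' \<in> {0..T}" using that mem by auto
      ultimately show ?thesis using c[OF v, of s' t'] by linarith
    qed
    have "conc (inc X s u) (inc X u t) w = inc X s t w" using one mem by (simp add: inc_chen)
    then have "inc X s t w - inc X s u w - inc X u t w =
        (\<Sum>(a, b)\<in>proper_splits w. inc X s u a * inc X u t b)"
      using one mem by (simp add: conc_proper[OF w] inc_Nil)
    also have "\<bar>\<dots>\<bar> \<le> (\<Sum>(a, b)\<in>proper_splits w. \<bar>c a\<bar> * \<bar>c b\<bar> * gauge \<gamma> (s, t) ^ length w)"
    proof (rule order.trans[OF sum_abs], rule sum_mono, clarify)
      fix a b' assume ab: "(a, b') \<in> proper_splits w"
      have "\<bar>inc X s u a * inc X u t b'\<bar> \<le>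
          (\<bar>c a\<bar> * gauge \<gamma> (s, t) ^ length a) * (\<bar>c b'\<bar> * gauge \<gamma> (s, t) ^ length b')"
        unfolding abs_mult using proper_splitsD[OF ab] st by (intro mult_mono b) auto
      also have "\<dots> = \<bar>c a\<bar> * \<bar>c b'\<bar> * gauge \<gamma> (s, t) ^ (length a + length b')"
        by (simp add: power_add)
      finally show "\<bar>inc X s u a * inc X u t b'\<bar> \<le> \<bar>c a\<bar> * \<bar>c b'\<bar> * gauge \<gamma> (s, t) ^ length w"
        using proper_splitsD[OF ab] by simp
    qed
    also have "\<dots> = C * gauge \<gamma> (s, t) ^ length w"
      by (simp add: C_def sum_distrib_right case_prod_unfold)
    finally show ?thesis using st w by (simp add: gauge_power)
  qed
  moreover have "0 \<le> C" by (auto simp: C_def intro!: sum_nonneg)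
  ultimately show ?thesis by blast
qed

text \<open>
  The failure of the shuffle relation is additive at the first level where it can occur: in
  the product $\mathbf{X}_s \mathbf{X}_{st}$, all proper factorisations of the pair of words involve levels at which both
  factors satisfy the relation.
\<close>

lemma coshuffle_defect_increment:
  assumes X: "group_like (words_upto m) (X s)" "group_like (words_upto m) (X t)"
    and uv: "length u + length v = Suc m"
  shows "(coshuffle (X t) (u, v) - X t u * X t v) - (coshuffle (X s) (u, v) - X s u * X s v) =
    coshuffle (inc X s t) (u, v) - inc X s t u * inc X s t v"
proof -
  let ?x = "X s" and ?y = "inc X s t"
  have y: "group_like (words_upto m) ?y" using X by (simp add: group_like_inc)
  have one: "?x [] = 1" "?y [] = 1" using X y by (simp_all add: group_like_def)
  have ne: "u @ v \<noteq> []" using uv by auto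
  have "(\<Sum>((u1, u2), (v1, v2))\<in>proper_splits2 u v. coshuffle ?x (u1, v1) * coshuffle ?y (u2, v2)) =
      (\<Sum>((u1, u2), (v1, v2))\<in>proper_splits2 u v. tensor ?x ?x (u1, v1) * tensor ?y ?y (u2, v2))"
  proof (rule sum.cong[OF refl], clarify)
    fix u1 u2 v1 v2 assume "((u1, u2), (v1, v2)) \<in> proper_splits2 u v"
    then have "u1 @ v1 \<in> words_upto m" "u2 @ v2 \<in> words_upto m"
      using proper_splits2D[of u1 u2 v1 v2 u v] uv by (auto simp: words_upto_def)
    then show "coshuffle ?x (u1, v1) * coshuffle ?y (u2, v2) = tensor ?x ?x (u1, v1) * tensor ?y ?y (u2, v2)"
      using X y by (simp add: group_like_def tensor_def)
  qed
  moreover have "coshuffle (X t) (u, v) = conc2 (coshuffle ?x) (coshuffle ?y) (u, v)"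
    by (simp add: conc_inc one coshuffle_conc[symmetric])
  moreover have "X t u * X t v = conc2 (tensor ?x ?x) (tensor ?y ?y) (u, v)"
    by (simp add: conc2_tensor conc_inc one) (simp add: tensor_def)
  ultimately show ?thesis
    by (simp add: conc2_proper[OF ne] coshuffle_single_left one) (simp add: tensor_def one)
qed

text \<open>
  The defect of the shuffle relation has increments of order $\gamma (m+1) > 1$, hence is constant, and
  it vanishes at time 0, where the path is the unit.
\<close>

lemma group_like_next_level:
  fixes X :: "real \<Rightarrow> ('d::finite) series"
  assumes group_like: "\<forall>t\<in>{0..T}. group_like (words_upto m) (X t)"
    and zero: "\<forall>w\<in>words_upto (Suc m). X 0 w = unit w"
    and hoelder: "\<forall>w\<in>words_upto (Suc m). graded_hoelder \<gamma> ({0..T} \<times> {0..T}) X w"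
    and \<gamma>: "1 < \<gamma> * real (Suc m)" and t: "t \<in> {0..T}"
  shows "group_like (words_upto (Suc m)) (X t)"
  unfolding group_like_def
proof (intro conjI allI impI)
  show "X t [] = 1" using group_like t by (simp add: group_like_def)
next
  fix u v :: "'d list" assume uv: "u @ v \<in> words_upto (Suc m)"
  show "coshuffle (X t) (u, v) = X t u * X t v"
  proof (cases "u @ v \<in> words_upto m")
    case True
    then show ?thesis using group_like t by (simp add: group_like_def)
  next
    case False
    then have len: "length u + length v = Suc m" using uv by (simp add: words_upto_def)
    define D where "D t = coshuffle (X t) (u, v) - X t u * X t v" for t
    let ?F = "principal ({0..T} \<times> {0..T})"
    have "(\<lambda>p. coshuffle (inc X (fst p) (snd p)) (u, v)) \<in> O[?F](\<lambda>p. gauge \<gamma> p ^ Suc m)"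
      unfolding coshuffle_def prod.case
    proof (intro big_sum_in_bigo)
      fix w :: "'d list" assume "w \<in> {w. length w = length u + length v}"
      then have w: "length w = Suc m" using len by simp
      then have "w \<in> words_upto (Suc m)" by (simp add: words_upto_def)
      with hoelder have "graded_hoelder \<gamma> ({0..T} \<times> {0..T}) X w" ..
      with w show "(\<lambda>p. inc X (fst p) (snd p) w * coshuffle_word w (u, v)) \<in> O[?F](\<lambda>p. gauge \<gamma> p ^ Suc m)"
        by (intro bigo_mult_pow[of _ _ _ "length w" _ 0]) simp_all
    qed
    moreover have "(\<lambda>p. inc X (fst p) (snd p) u * inc X (fst p) (snd p) v) \<in> O[?F](\<lambda>p. gauge \<gamma> p ^ Suc m)"
      using hoelder len by (intro bigo_mult_pow[of _ _ _ "length u" _ "length v"]) (auto simp: words_upto_def)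
    ultimately have "(\<lambda>p. coshuffle (inc X (fst p) (snd p)) (u, v) - inc X (fst p) (snd p) u * inc X (fst p) (snd p) v)
        \<in> O[?F](\<lambda>p. gauge \<gamma> p ^ Suc m)"
      by (rule sum_in_bigo)
    from bigo_squareD[OF this]
    obtain C where C: "\<bar>coshuffle (inc X s t) (u, v) - inc X s t u * inc X s t v\<bar> \<le> C * gauge \<gamma> (s, t) ^ Suc m"
      if "s \<in> {0..T}" "t \<in> {0..T}" for s t
      by (simp only: fst_conv snd_conv) blast
    have "D t = D 0"
    proof (rule hoelder_gt_one_constant[OF \<gamma>])
      show "\<bar>D t - D s\<bar> \<le> C * (t - s) powr (\<gamma> * real (Suc m))" if "0 \<le> s" "s \<le> t" "t \<le> T" for s t
        using C[of s t] that coshuffle_defect_increment[of m X s t u v] group_like len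
        by (simp add: D_def gauge_power del: power_Suc of_nat_Suc)
    qed (use t in auto)
    also have "D 0 = coshuffle unit (u, v) - unit u * unit v"
    proof -
      have "coshuffle (X 0) (u, v) = coshuffle unit (u, v)"
        using zero len by (intro coshuffle_cong) (auto simp: words_upto_def)
      moreover have "X 0 u = unit u" "X 0 v = unit v" using zero len by (auto simp: words_upto_def)
      ultimately show ?thesis by (simp add: D_def)
    qed
    also have "\<dots> = 0" using group_like_unit[of "UNIV :: 'd list set"] by (simp add: group_like_def)
    finally show ?thesis by (simp add: D_def)
  qed
qed

text \<open>
  Let $Z$ be the path with level $m+1$ set to zero. Adding a function $F$ to its coefficient at a word of
  length $m+1$ adds the increments of $F$ to the increment of $Z$ there. So $F$ must have increments close to
  $-Z_{st}$ at that word, and the sewing lemma provides it, because $Z_{st}$ satisfies Chen's relation.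
\<close>

lemma rough_extend_Suc:
  fixes X :: "real \<Rightarrow> ('d::finite) series"
  assumes X: "rough (words_upto m) \<gamma> T X" and \<gamma>: "0 < \<gamma>" "1 < \<gamma> * real (Suc m)" and T: "0 < T"
  shows "\<exists>Y. rough (words_upto (Suc m)) \<gamma> T Y \<and> (\<forall>t. \<forall>w\<in>words_upto m. Y t w = X t w)"
proof -
  define \<theta> where "\<theta> = \<gamma> * real (Suc m)"
  define Z where "Z t = trunc m (X t)" for t
  have agree: "Z t w = X t w" if "w \<in> words_upto m" for t w
    using that by (simp add: Z_def trunc_def words_upto_def)
  have Z: "rough (words_upto m) \<gamma> T Z"
    by (rule rough_cong[OF _ _ _ X]) (use T in \<open>auto simp: agree\<close>)
  have one: "\<forall>t\<in>{0..T}. Z t [] = 1" using rough_one[OF Z] by blast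
  have "\<exists>F K. F 0 = (0 :: real) \<and> (\<forall>s t. 0 \<le> s \<and> s \<le> t \<and> t \<le> T \<longrightarrow>
      \<bar>F t - F s + inc Z s t w\<bar> \<le> K * (t - s) powr \<theta>)" if w: "length w = Suc m" for w
  proof -
    have "\<exists>C\<ge>0. \<forall>s u t. 0 \<le> s \<and> s \<le> u \<and> u \<le> t \<and> t \<le> T \<longrightarrow>
        \<bar>inc Z s t w - inc Z s u w - inc Z u t w\<bar> \<le> C * (t - s) powr (\<gamma> * real (length w))"
      using Z w by (intro increment_defect_bound one \<gamma>) (auto simp: rough_def words_upto_def)
    then obtain C where C: "0 \<le> C" "\<And>s u t. 0 \<le> s \<Longrightarrow> s \<le> u \<Longrightarrow> u \<le> t \<Longrightarrow> t \<le> T \<Longrightarrow>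
        \<bar>inc Z s t w - inc Z s u w - inc Z u t w\<bar> \<le> C * (t - s) powr \<theta>"
      unfolding w \<theta>_def by blast
    interpret almost_additive "\<lambda>s t. - inc Z s t w" C \<theta> T
    proof
      show "\<bar>- inc Z s t w - - inc Z s u w - - inc Z u t w\<bar> \<le> C * (t - s) powr \<theta>"
        if "0 \<le> s" "s \<le> u" "u \<le> t" "t \<le> T" for s u t
        using C(2)[OF that] by linarith
    qed (use \<gamma> T C in \<open>auto simp: \<theta>_def\<close>)
    obtain F where "F 0 = 0"
      "\<And>s t. 0 \<le> s \<Longrightarrow> s \<le> t \<Longrightarrow> t \<le> T \<Longrightarrow> \<bar>F t - F s - - inc Z s t w\<bar> \<le> K * (t - s) powr \<theta>"
      using sewing by blast
    then show ?thesis by (intro exI[of _ F] exI[of _ K]) simp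
  qed
  then obtain F K where F0: "F w 0 = (0 :: real)"
    and F: "0 \<le> s \<Longrightarrow> s \<le> t \<Longrightarrow> t \<le> T \<Longrightarrow> \<bar>F w t - F w s + inc Z s t w\<bar> \<le> K w * (t - s) powr \<theta>"
    if "length w = Suc m" for w s t
    by metis
  define Y where "Y t w = (if length w = Suc m then F w t else Z t w)" for t w
  have low: "Y t w = Z t w" if "w \<in> words_upto m" for t w
    using that by (simp add: Y_def words_upto_def)
  have rough_low: "rough (words_upto m) \<gamma> T Y"
    by (rule rough_cong[OF _ _ _ Z]) (use T in \<open>auto simp: low\<close>)
  have oneY: "\<forall>t\<in>{0..T}. Y t [] = 1" using rough_one[OF rough_low] by blast
  have sub: "principal (ordered_pairs T) \<le> principal ({0..T} \<times> {0..T})"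
    by (auto simp: ordered_pairs_def)
  have ordered: "graded_hoelder \<gamma> (ordered_pairs T) Y w" if "w \<in> words_upto (Suc m)" for w
  proof (cases "length w = Suc m")
    case True
    have "inc Y s t w = F w t - F w s + inc Z s t w" if "s \<in> {0..T}" "t \<in> {0..T}" for s t
      using that one True
      by (subst inc_change_top[of w s t Y Z]) (auto simp: low words_upto_def, auto simp: Y_def Z_def trunc_def)
    then have "\<bar>inc Y s t w\<bar> \<le> K w * gauge \<gamma> (s, t) ^ length w" if "(s, t) \<in> ordered_pairs T" for s t
      using that F[OF True, of s t]
      by (simp add: ordered_pairs_def True gauge_power \<theta>_def del: power_Suc of_nat_Suc)
    then show ?thesis unfolding graded_hoelder_iff by blast
  next
    case False
    then have "graded_hoelder \<gamma> ({0..T} \<times> {0..T}) Y w"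
      using that rough_low by (simp add: rough_def words_upto_def)
    then show ?thesis by (rule landau_o.big.filter_mono[OF sub])
  qed
  have hoelder: "\<forall>w\<in>words_upto (Suc m). graded_hoelder \<gamma> ({0..T} \<times> {0..T}) Y w"
    by (intro ballI graded_hoelder_ordered_pairs oneY ordered) (auto simp: words_upto_def)
  have "Y 0 w = unit w" if "w \<in> words_upto (Suc m)" for w
  proof (cases "length w = Suc m")
    case True
    then show ?thesis by (cases w) (auto simp: Y_def F0)
  next
    case False
    then show ?thesis using that Z low by (simp add: rough_def words_upto_def)
  qed
  then have "rough (words_upto (Suc m)) \<gamma> T Y"
    using group_like_next_level[of T m Y \<gamma>] hoelder rough_low \<gamma>(2)
    unfolding rough_def by blast
  moreover have "Y t w = X t w" if "w \<in> words_upto m" for t w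
    using that by (simp add: low agree)
  ultimately show ?thesis by blast
qed

text \<open>
  The difference of the two paths at a word of length $m+1$ has increments of order $\gamma (m+1) > 1$.
\<close>

lemma rough_unique_Suc:
  fixes X Y :: "real \<Rightarrow> ('d::finite) series"
  assumes X: "rough (words_upto (Suc m)) \<gamma> T X" and Y: "rough (words_upto (Suc m)) \<gamma> T Y"
    and \<gamma>: "1 < \<gamma> * real (Suc m)"
    and agree: "\<And>t w. t \<in> {0..T} \<Longrightarrow> w \<in> words_upto m \<Longrightarrow> X t w = Y t w"
    and t: "t \<in> {0..T}" and w: "w \<in> words_upto (Suc m)"
  shows "X t w = Y t w"
proof (cases "w \<in> words_upto m")
  case False
  then have len: "length w = Suc m" using w by (simp add: words_upto_def)
  let ?F = "principal ({0..T} \<times> {0..T})"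
  have "(\<lambda>p. inc X (fst p) (snd p) w - inc Y (fst p) (snd p) w) \<in> O[?F](\<lambda>p. gauge \<gamma> p ^ Suc m)"
    using X Y w len by (intro sum_in_bigo) (auto simp: rough_def)
  from bigo_squareD[OF this] obtain C where C: "\<bar>inc X s t w - inc Y s t w\<bar> \<le> C * gauge \<gamma> (s, t) ^ Suc m"
    if "s \<in> {0..T}" "t \<in> {0..T}" for s t
    by (simp only: fst_conv snd_conv) blast
  have "X t w - Y t w = X 0 w - Y 0 w"
  proof (rule hoelder_gt_one_constant[OF \<gamma>])
    show "\<bar>(X t w - Y t w) - (X s w - Y s w)\<bar> \<le> C * (t - s) powr (\<gamma> * real (Suc m))"
      if "0 \<le> s" "s \<le> t" "t \<le> T" for s t
    proof -
      have "inc X s t w = inc Y s t w + (X t w - Y t w) - (X s w - Y s w)"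
        using that len rough_one[OF Y] by (intro inc_change_top agree) (auto simp: words_upto_def)
      then show ?thesis using C[of s t] that by (simp add: gauge_power del: power_Suc of_nat_Suc)
    qed
  qed (use t in auto)
  moreover have "X 0 w = Y 0 w" using X Y w by (simp add: rough_def)
  ultimately show ?thesis by simp
qed (use agree t in blast)

lemma rough_unique:
  fixes X Y :: "real \<Rightarrow> ('d::finite) series"
  assumes X: "rough UNIV \<gamma> T X" and Y: "rough UNIV \<gamma> T Y"
    and \<gamma>: "0 < \<gamma>" "1 < \<gamma> * real (Suc n)"
    and agree: "\<And>t w. t \<in> {0..T} \<Longrightarrow> w \<in> words_upto n \<Longrightarrow> X t w = Y t w"
    and t: "t \<in> {0..T}"
  shows "X t = Y t"
proof -
  have eq: "\<forall>t\<in>{0..T}. \<forall>w\<in>words_upto (n + k). X t w = Y t w" for k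
  proof (induction k)
    case (Suc k)
    have "1 < \<gamma> * real (Suc (n + k))"
      by (rule less_le_trans[OF \<gamma>(2)]) (use \<gamma> in \<open>auto intro!: mult_left_mono\<close>)
    then show ?case
      using X Y rough_unique_Suc[of "n + k" \<gamma> T X Y] Suc by (auto simp: rough_UNIV_iff)
  qed (use agree in simp)
  have "X t w = Y t w" for w
    using eq[of "length w"] t by (simp add: words_upto_def)
  then show ?thesis by blast
qed

text \<open>
  The successive extensions are consistent, so the coefficient at $w$ may be read off from any of
  them that has reached the length of $w$; the one with index $|w|$ has level $n + |w|$.
\<close>

lemma rough_extend:
  fixes X :: "real \<Rightarrow> ('d::finite) series"
  assumes X: "rough (words_upto n) \<gamma> T X" and \<gamma>: "0 < \<gamma>" "1 < \<gamma> * real (Suc n)" and T: "0 < T"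
  obtains Y where "rough UNIV \<gamma> T Y" "\<And>t w. w \<in> words_upto n \<Longrightarrow> Y t w = X t w"
proof -
  have "\<exists>f. \<forall>k. (rough (words_upto (n + k)) \<gamma> T (f k) \<and> (k = 0 \<longrightarrow> f k = X)) \<and>
      (\<forall>t. \<forall>w\<in>words_upto (n + k). f (Suc k) t w = f k t w)"
  proof (rule dependent_nat_choice)
    fix Y k assume Y: "rough (words_upto (n + k)) \<gamma> T Y \<and> (k = 0 \<longrightarrow> Y = X)"
    have "1 < \<gamma> * real (Suc (n + k))"
      by (rule less_le_trans[OF \<gamma>(2)]) (use \<gamma> in \<open>auto intro!: mult_left_mono\<close>)
    with rough_extend_Suc[OF conjunct1[OF Y] \<gamma>(1) _ T]
    show "\<exists>Z. (rough (words_upto (n + Suc k)) \<gamma> T Z \<and> (Suc k = 0 \<longrightarrow> Z = X)) \<and>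
        (\<forall>t. \<forall>w\<in>words_upto (n + k). Z t w = Y t w)"
      by simp
  qed (use X in simp)
  then obtain f where f: "rough (words_upto (n + k)) \<gamma> T (f k)" "f 0 = X"
    "\<And>t w. w \<in> words_upto (n + k) \<Longrightarrow> f (Suc k) t w = f k t w" for k
    by blast
  define Y where "Y t w = f (length w) t w" for t w
  \<comment> \<open>Later extensions leave the levels already reached unchanged.\<close>
  have stable: "f (k + j) t w = f k t w" if "length w \<le> n + k" for k j t w
    using that by (induction j) (auto simp: f(3) words_upto_def)
  have Y: "Y t w = f k t w" if "w \<in> words_upto (n + k)" for t w k
    using that stable[of w k "length w - k" t] stable[of w "length w" "k - length w" t]
    by (cases "k \<le> length w") (auto simp: words_upto_def Y_def)
  have "rough (words_upto k) \<gamma> T Y" for k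
  proof -
    have "rough (words_upto (n + k)) \<gamma> T Y"
      by (rule rough_cong[OF _ _ _ f(1)]) (use T Y in auto)
    then show ?thesis
      unfolding rough_def group_like_def by (auto simp: words_upto_def)
  qed
  then have "rough UNIV \<gamma> T Y" by (simp add: rough_UNIV_iff)
  moreover have "Y t w = X t w" if "w \<in> words_upto n" for t w
    using Y[of w 0] that f(2) by simp
  ultimately show ?thesis by (rule that)
qed

section \<open>Rough paths as functionals on words\<close>

lemma pairing_finite_superset:
  assumes "finite A" "{w. p w \<noteq> 0} \<subseteq> A"
  shows "pairing p x = (\<Sum>w\<in>A. p w * x w)"
  unfolding pairing_def using assms by (intro sum.mono_neutral_left) auto

lemma pairing_word [simp]: "pairing (word w) x = x w"
  by (simp add: pairing_def word_def)

lemma pairing_cong: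
  assumes "p \<in> free_space W" "\<And>w. w \<in> W \<Longrightarrow> x w = y w"
  shows "pairing p x = pairing p y"
  unfolding pairing_def using assms by (intro sum.cong) (auto simp: free_space_def)

lemma word_in_free_space [simp]: "word w \<in> free_space W \<longleftrightarrow> w \<in> W"
  by (simp add: free_space_def word_def)

lemma shuffle_in_free_space:
  assumes "level_set W" "u @ v \<in> W"
  shows "shuffle u (v :: ('d::finite) list) \<in> free_space W"
proof -
  have "{w. shuffle u v w \<noteq> 0} \<subseteq> {w. length w = length u + length v}"
    by (auto dest: shuffle_length)
  moreover have "finite {w :: 'd list. length w = length u + length v}"
    using finite_lists_length_eq[of "UNIV :: 'd set" "length u + length v"] by simp
  ultimately have "finite {w. shuffle u v w \<noteq> 0}" by (rule finite_subset)
  moreover have "{w. shuffle u v w \<noteq> 0} \<subseteq> W"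
    using level_setD[OF assms] by (auto dest!: shuffle_length)
  ultimately show ?thesis by (simp add: free_space_def)
qed

lemma pairing_in_dual: "(\<lambda>p\<in>free_space W. pairing p x) \<in> dual (free_space W)"
proof -
  have add: "(\<lambda>w. p w + q w) \<in> free_space W \<and> pairing (\<lambda>w. p w + q w) x = pairing p x + pairing q x"
    if p: "p \<in> free_space W" and q: "q \<in> free_space W" for p q
  proof -
    let ?A = "{w. p w \<noteq> 0} \<union> {w. q w \<noteq> 0}"
    have A: "finite ?A" "?A \<subseteq> W" "{w. p w + q w \<noteq> 0} \<subseteq> ?A"
      using p q by (auto simp: free_space_def)
    then have "(\<lambda>w. p w + q w) \<in> free_space W"
      using finite_subset[OF A(3,1)] by (auto simp: free_space_def)
    moreover have "pairing (\<lambda>w. p w + q w) x = pairing p x + pairing q x"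
      using A by (subst (1 2 3) pairing_finite_superset[of ?A]) (auto simp: distrib_right sum.distrib)
    ultimately show ?thesis ..
  qed
  have scale: "(\<lambda>w. c * p w) \<in> free_space W \<and> pairing (\<lambda>w. c * p w) x = c * pairing p x"
    if p: "p \<in> free_space W" for p c
  proof -
    have A: "finite {w. p w \<noteq> 0}" "{w. p w \<noteq> 0} \<subseteq> W" "{w. c * p w \<noteq> 0} \<subseteq> {w. p w \<noteq> 0}"
      using p by (auto simp: free_space_def)
    then have "(\<lambda>w. c * p w) \<in> free_space W"
      using finite_subset[OF A(3,1)] by (auto simp: free_space_def)
    moreover have "pairing (\<lambda>w. c * p w) x = c * pairing p x"
      using A by (subst (1 2) pairing_finite_superset[of "{w. p w \<noteq> 0}"])
        (auto simp: sum_distrib_left mult.assoc)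
    ultimately show ?thesis ..
  qed
  show ?thesis unfolding dual_def using add scale by auto
qed

text \<open>
  A linear functional is determined by its values on the basis of words; the induction runs over
  the finite support.
\<close>

lemma dual_eq_pairing:
  assumes f: "f \<in> dual (free_space W)" and p: "p \<in> free_space W"
  shows "f p = pairing p (\<lambda>w. f (word w))"
proof -
  have add: "f (\<lambda>w. p w + q w) = f p + f q" if "p \<in> free_space W" "q \<in> free_space W" for p q
    using f that by (simp add: dual_def)
  have scale: "f (\<lambda>w. c * p w) = c * f p" if "p \<in> free_space W" for c p
    using f that by (simp add: dual_def)
  have "f q = (\<Sum>w\<in>A. q w * f (word w))"
    if "finite A" "A \<subseteq> W" "{w. q w \<noteq> 0} \<subseteq> A" for A q
    using that
  proof (induction A arbitrary: q rule: finite_induct)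
    case empty
    then have "q = (\<lambda>w. 0)" by auto
    then show ?case using scale[OF p, of 0] by simp
  next
    case (insert a A)
    let ?q = "q(a := 0)"
    have supp: "{w. ?q w \<noteq> 0} \<subseteq> A" using insert.prems by auto
    have q': "?q \<in> free_space W"
      using finite_subset[OF supp insert.hyps(1)] supp insert.prems by (auto simp: free_space_def)
    have a: "(word a :: 'a series) \<in> free_space W" using insert.prems by simp
    have a': "(\<lambda>w. q a * word a w) \<in> free_space W"
      using insert.prems by (auto simp: free_space_def word_def)
    have "q = (\<lambda>w. ?q w + q a * word a w)" by (auto simp: word_def)
    then have "f q = f (\<lambda>w. ?q w + q a * word a w)" by simp
    also have "\<dots> = f ?q + q a * f (word a)" using add[OF q' a'] scale[OF a] by simp
    also have "f ?q = (\<Sum>w\<in>A. ?q w * f (word w))"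
      using insert.prems supp by (intro insert.IH) auto
    also have "\<dots> = (\<Sum>w\<in>A. q w * f (word w))"
      using insert.hyps by (intro sum.cong) auto
    finally show ?case using insert.hyps by simp
  qed
  from this[of "{w. p w \<noteq> 0}" p] p show ?thesis by (simp add: free_space_def pairing_def)
qed

lemma tensor_functional_deconc:
  "tensor_functional f g (deconc_word w) = (\<Sum>(u, v)\<in>splits w. f (word u) * g (word v))"
proof -
  have deconc: "deconc_word w (u, v) = (if u @ v = w then 1 else 0)" for u v
  proof -
    have "deconc_word w (u, v) = (\<Sum>k\<le>length w. if k = length u \<and> u @ v = w then 1 else 0)"
      unfolding deconc_word_def tensor_def word_def
      by (intro sum.cong refl) (auto simp: append_eq_conv_conj)
    also have "\<dots> = (if u @ v = w then 1 else 0)" by (auto simp: sum.delta)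
    finally show ?thesis .
  qed
  have "{(u, v). deconc_word w (u, v) \<noteq> 0} = splits w" by (auto simp: deconc splits_def)
  then show ?thesis
    unfolding tensor_functional_def by (rule sum.cong) (auto simp: deconc splits_def)
qed

text \<open>
  The two functional-valued definitions at once, for words of bounded length and for all words.
\<close>

definition dual_rough :: "('d::finite) list set \<Rightarrow> real \<Rightarrow> real \<Rightarrow> (real \<times> real \<Rightarrow> 'd series \<Rightarrow> real) set"
  where "dual_rough W \<gamma> T = {X \<in> {0..T} \<times> {0..T} \<rightarrow>\<^sub>E dual (free_space W).
    (\<forall>s\<in>{0..T}. \<forall>t\<in>{0..T}. X (s, t) unit = 1 \<and>
      (\<forall>w1 w2. w1 @ w2 \<in> W \<longrightarrow>
        X (s, t) (shuffle w1 w2) = X (s, t) (word w1) * X (s, t) (word w2))) \<and>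
    (\<forall>t\<in>{0..T}. X (t, t) = counit (free_space W)) \<and>
    (\<forall>s\<in>{0..T}. \<forall>u\<in>{0..T}. \<forall>t\<in>{0..T}. \<forall>w\<in>W.
      X (s, t) (word w) = tensor_functional (X (s, u)) (X (u, t)) (deconc_word w)) \<and>
    (\<forall>w\<in>W. bdd_above {\<bar>X (s, t) (word w)\<bar> / \<bar>t - s\<bar> powr (\<gamma> * real (length w)) | s t.
        s \<in> {0..T} \<and> t \<in> {0..T} \<and> s \<noteq> t})}"

lemma R_check_eq: "R_check \<gamma> T = dual_rough (words_upto (level \<gamma>)) \<gamma> T"
  by (simp add: R_check_def dual_rough_def words_upto_def)

lemma R_hat_eq: "R_hat \<gamma> T = dual_rough UNIV \<gamma> T"
  by (simp add: R_hat_def dual_rough_def)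

definition rough_paths :: "('d::finite) list set \<Rightarrow> real \<Rightarrow> real \<Rightarrow> (real \<Rightarrow> 'd series) set"
  where "rough_paths W \<gamma> T = {X \<in> extensional {0..T}.
    (\<forall>t\<in>{0..T}. \<forall>w. w \<notin> W \<longrightarrow> X t w = 0) \<and> rough W \<gamma> T X}"

lemma not_in_words_upto: "w \<notin> words_upto n \<longleftrightarrow> n < length w"
  by (auto simp: words_upto_def)

lemma R_eq: "0 < T \<Longrightarrow> R \<gamma> T = rough_paths (words_upto (level \<gamma>)) \<gamma> T"
  by (auto simp: R_iff rough_paths_def trunc_space_iff not_in_words_upto)

lemma R_bar_eq: "0 < T \<Longrightarrow> R_bar \<gamma> T = rough_paths UNIV \<gamma> T"
  by (auto simp: R_bar_iff rough_paths_def)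

definition to_dual :: "'d list set \<Rightarrow> real \<Rightarrow> (real \<Rightarrow> 'd series) \<Rightarrow> (real \<times> real \<Rightarrow> 'd series \<Rightarrow> real)"
  where "to_dual W T X = (\<lambda>(s, t)\<in>{0..T} \<times> {0..T}. \<lambda>p\<in>free_space W. pairing p (inc X s t))"

text \<open>
  On the diagonal the increment is the unit, where the gauge bound holds with constant 1; hence
  \<open>max c 1\<close> in the passage from distinct to arbitrary times.
\<close>

lemma graded_hoelder_iff_bdd_above:
  assumes one: "\<forall>t\<in>{0..T}. X t [] = 1"
  shows "graded_hoelder \<gamma> ({0..T} \<times> {0..T}) X w \<longleftrightarrow>
    bdd_above {\<bar>inc X s t w\<bar> / \<bar>t - s\<bar> powr (\<gamma> * real (length w)) | s t.
        s \<in> {0..T} \<and> t \<in> {0..T} \<and> s \<noteq> t}"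
proof -
  have gauge: "gauge \<gamma> (s, t) ^ length w = \<bar>t - s\<bar> powr (\<gamma> * real (length w))" if "s \<noteq> t" for s t
    using that by (simp add: gauge_def powr_power mult.commute)
  have "bdd_above {\<bar>inc X s t w\<bar> / \<bar>t - s\<bar> powr (\<gamma> * real (length w)) | s t.
        s \<in> {0..T} \<and> t \<in> {0..T} \<and> s \<noteq> t} \<longleftrightarrow>
     (\<exists>c. \<forall>s t. s \<in> {0..T} \<and> t \<in> {0..T} \<and> s \<noteq> t \<longrightarrow> \<bar>inc X s t w\<bar> \<le> c * gauge \<gamma> (s, t) ^ length w)"
    (is "_ \<longleftrightarrow> ?B") by (subst bdd_above_quotient_iff) (auto simp: gauge simp del: atLeastAtMost_iff)
  also have "?B \<longleftrightarrow> graded_hoelder \<gamma> ({0..T} \<times> {0..T}) X w"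
  proof
    assume ?B
    then obtain c where c: "\<bar>inc X s t w\<bar> \<le> c * gauge \<gamma> (s, t) ^ length w"
      if "s \<in> {0..T}" "t \<in> {0..T}" "s \<noteq> t" for s t by blast
    have "\<bar>inc X s t w\<bar> \<le> max c 1 * gauge \<gamma> (s, t) ^ length w" if "s \<in> {0..T}" "t \<in> {0..T}" for s t
    proof (cases "s = t")
      case True
      then show ?thesis using one that by (cases w) (simp_all add: inc_same)
    next
      case False
      have "c * gauge \<gamma> (s, t) ^ length w \<le> max c 1 * gauge \<gamma> (s, t) ^ length w"
        by (intro mult_right_mono) auto
      then show ?thesis using c[OF that False] by linarith
    qed
    then show "graded_hoelder \<gamma> ({0..T} \<times> {0..T}) X w" unfolding graded_hoelder_iff by blast
  next
    assume "graded_hoelder \<gamma> ({0..T} \<times> {0..T}) X w"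
    then show ?B unfolding graded_hoelder_iff by blast
  qed
  finally show ?thesis ..
qed

text \<open>
  Each condition on the functionals is the corresponding condition on the coefficients of the
  increments, paired with words: the character property is group-likeness, the relation with the
  deconcatenation coproduct is Chen's relation. The path is recovered from the functionals with first
  argument 0, because paths start at the unit.
\<close>

lemma bij_betw_to_dual:
  fixes W :: "('d::finite) list set"
  assumes W: "level_set W" and T: "0 < T"
  shows "bij_betw (to_dual W T) (rough_paths W \<gamma> T) (dual_rough W \<gamma> T)"
proof -
  note atLeastAtMost_iff [simp del]
  let ?I = "{0..T}" and ?V = "free_space W"
  have 0: "0 \<in> ?I" using T by (simp add: atLeastAtMost_iff)
  have Nil: "[] \<in> W" using W by (simp add: level_set_def)
  have factors: "u \<in> W" "v \<in> W" if "u @ v \<in> W" for u v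
    using level_setD[OF W that] by auto
  have eval: "to_dual W T X (s, t) p = pairing p (inc X s t)" if "s \<in> ?I" "t \<in> ?I" "p \<in> ?V" for X s t p
    using that by (simp add: to_dual_def)
  have into: "to_dual W T X \<in> dual_rough W \<gamma> T" if X: "X \<in> rough_paths W \<gamma> T" for X
  proof -
    have rough: "rough W \<gamma> T X" using X by (simp add: rough_paths_def)
    have one: "\<forall>t\<in>?I. X t [] = 1" using rough_one[OF rough] by blast
    have gl: "group_like W (inc X s t)" if "s \<in> ?I" "t \<in> ?I" for s t
      using rough that by (intro group_like_inc W) (simp_all add: rough_def)
    show ?thesis
      unfolding dual_rough_def mem_Collect_eq
    proof (intro conjI ballI allI impI)
      show "to_dual W T X \<in> ?I \<times> ?I \<rightarrow>\<^sub>E dual ?V"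
        by (auto simp: to_dual_def pairing_in_dual)
    next
      fix s t assume st: "s \<in> ?I" "t \<in> ?I"
      show "to_dual W T X (s, t) unit = 1"
        using st gl[OF st] Nil by (simp add: eval unit_def group_like_def)
      fix u v :: "'d list" assume uv: "u @ v \<in> W"
      show "to_dual W T X (s, t) (shuffle u v) = to_dual W T X (s, t) (word u) * to_dual W T X (s, t) (word v)"
        using gl[OF st] uv
        by (simp add: eval st shuffle_in_free_space[OF W uv] factors[OF uv] coshuffle_dual[symmetric] group_like_def)
    next
      fix t assume t: "t \<in> ?I"
      have "pairing p unit = p []" if "p \<in> ?V" for p :: "'d series"
      proof -
        have "pairing p unit = (\<Sum>w\<in>insert [] {w. p w \<noteq> 0}. p w * unit w)"
          using that by (intro pairing_finite_superset) (auto simp: free_space_def)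
        also have "\<dots> = (\<Sum>w\<in>insert [] {w. p w \<noteq> 0}. if w = [] then p [] else 0)"
          by (intro sum.cong) (auto simp: unit_def word_def)
        finally show ?thesis using that by (simp add: free_space_def)
      qed
      then have "restrict (\<lambda>p. pairing p unit) ?V = (counit ?V :: 'd series \<Rightarrow> real)"
        unfolding counit_def by (rule restrict_ext)
      moreover have "inc X t t = unit" using t one by (simp add: inc_same)
      ultimately show "to_dual W T X (t, t) = counit ?V"
        using t by (simp add: to_dual_def)
    next
      fix s u t and w :: "'d list" assume st: "s \<in> ?I" "u \<in> ?I" "t \<in> ?I" and w: "w \<in> W"
      have "a \<in> W \<and> b \<in> W" if "(a, b) \<in> splits w" for a b
        using factors[of a b] w that by (auto simp: splits_def)
      then have "tensor_functional (to_dual W T X (s, u)) (to_dual W T X (u, t)) (deconc_word w) =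
          conc (inc X s u) (inc X u t) w"
        unfolding tensor_functional_deconc conc_splits by (intro sum.cong) (auto simp: eval st)
      then show "to_dual W T X (s, t) (word w) =
          tensor_functional (to_dual W T X (s, u)) (to_dual W T X (u, t)) (deconc_word w)"
        using st w one by (simp add: eval inc_chen)
    next
      fix w assume w: "w \<in> W"
      have "{\<bar>to_dual W T X (s, t) (word w)\<bar> / \<bar>t - s\<bar> powr (\<gamma> * real (length w)) | s t.
            s \<in> ?I \<and> t \<in> ?I \<and> s \<noteq> t} =
          {\<bar>inc X s t w\<bar> / \<bar>t - s\<bar> powr (\<gamma> * real (length w)) | s t. s \<in> ?I \<and> t \<in> ?I \<and> s \<noteq> t}"
        using w by (intro Collect_cong ex_cong1) (auto simp: eval)
      then show "bdd_above {\<bar>to_dual W T X (s, t) (word w)\<bar> / \<bar>t - s\<bar> powr (\<gamma> * real (length w)) | s t.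
            s \<in> ?I \<and> t \<in> ?I \<and> s \<noteq> t}"
        using graded_hoelder_iff_bdd_above[where X = X and T = T and \<gamma> = \<gamma> and w = w, OF one] rough w by (simp only: rough_def)
    qed
  qed
  have inc_zero: "inc X 0 t w = X t w" if X: "X \<in> rough_paths W \<gamma> T" and "t \<in> ?I" "w \<in> W" for X t w
  proof -
    have "inc X 0 t w = conc (conc_inverse unit) (X t) w"
      unfolding inc_def using X level_setD[OF W that(3)]
      by (intro conc_cong conc_inverse_cong) (auto simp: rough_paths_def rough_def)
    also have "conc_inverse unit = (unit :: 'd series)"
      using conc_inverse_right[of "unit :: 'd series"] by simp
    finally show ?thesis by simp
  qed
  have inj: "inj_on (to_dual W T) (rough_paths W \<gamma> T)"
  proof (rule inj_onI)
    fix X Y assume X: "X \<in> rough_paths W \<gamma> T" and Y: "Y \<in> rough_paths W \<gamma> T"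
      and eq: "to_dual W T X = to_dual W T Y"
    have "X t w = Y t w" if t: "t \<in> ?I" for t w
    proof (cases "w \<in> W")
      case True
      have "inc X 0 t w = inc Y 0 t w"
        using eval[OF 0 t, of "word w" X] eval[OF 0 t, of "word w" Y] True eq by simp
      then show ?thesis using inc_zero X Y t True by simp
    next
      case False
      then show ?thesis using X Y t by (simp add: rough_paths_def)
    qed
    then show "X = Y"
      using X Y by (intro extensionalityI[of X ?I Y]) (auto simp: rough_paths_def)
  qed
  have surj: "\<exists>X\<in>rough_paths W \<gamma> T. to_dual W T X = \<Phi>" if \<Phi>: "\<Phi> \<in> dual_rough W \<gamma> T" for \<Phi>
  proof -
    \<comment> \<open>The series representing the functionals; they become the increments of the path.\<close>
    define Y where "Y s t w = (if w \<in> W then \<Phi> (s, t) (word w) else 0)" for s t w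
    define X where "X = (\<lambda>t\<in>?I. Y 0 t)"
    have dual: "\<Phi> (s, t) \<in> dual ?V" if "s \<in> ?I" "t \<in> ?I" for s t
      using \<Phi> that by (auto simp: dual_rough_def)
    have \<Phi>_eq: "\<Phi> (s, t) p = pairing p (Y s t)" if "s \<in> ?I" "t \<in> ?I" "p \<in> ?V" for s t p
      using dual_eq_pairing[OF dual[OF that(1,2)] that(3)] pairing_cong[OF that(3), of "Y s t"]
      by (simp add: Y_def)
    have gl: "group_like W (Y s t)" if st: "s \<in> ?I" "t \<in> ?I" for s t
      unfolding group_like_def
    proof (intro conjI allI impI)
      have "\<Phi> (s, t) (word []) = 1" using \<Phi> st by (simp add: dual_rough_def unit_def)
      then show "Y s t [] = 1" using Nil by (simp add: Y_def)
      fix u v :: "'d list" assume uv: "u @ v \<in> W"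
      have "\<Phi> (s, t) (shuffle u v) = \<Phi> (s, t) (word u) * \<Phi> (s, t) (word v)"
        using \<Phi> st uv by (simp add: dual_rough_def)
      then show "coshuffle (Y s t) (u, v) = Y s t u * Y s t v"
        using factors[OF uv] by (simp add: coshuffle_dual \<Phi>_eq st shuffle_in_free_space[OF W uv])
    qed
    have chen: "conc (Y s u) (Y u t) w = Y s t w"
      if "s \<in> ?I" "u \<in> ?I" "t \<in> ?I" "w \<in> W" for s u t w
    proof -
      have "\<Phi> (s, t) (word w) = tensor_functional (\<Phi> (s, u)) (\<Phi> (u, t)) (deconc_word w)"
        using \<Phi> that unfolding dual_rough_def by blast
      then have "Y s t w = tensor_functional (\<Phi> (s, u)) (\<Phi> (u, t)) (deconc_word w)"
        using that by (simp add: Y_def)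
      also have "\<dots> = conc (Y s u) (Y u t) w"
        unfolding tensor_functional_deconc conc_splits
      proof (rule sum.cong[OF refl], clarify)
        fix a b assume "(a, b) \<in> splits w"
        then have "a @ b \<in> W" using that(4) by (simp add: splits_def)
        then show "\<Phi> (s, u) (word a) * \<Phi> (u, t) (word b) = Y s u a * Y u t b"
          using factors[of a b] by (simp add: Y_def)
      qed
      finally show ?thesis ..
    qed
    have one: "\<forall>t\<in>?I. X t [] = 1" using gl 0 by (simp add: X_def group_like_def)
    have inc: "inc X s t w = Y s t w" if st: "s \<in> ?I" "t \<in> ?I" "w \<in> W" for s t w
    proof -
      have "inc X s t w = conc (conc_inverse (Y 0 s)) (Y 0 t) w"
        using st by (simp add: inc_def X_def)
      also have "\<dots> = conc (conc_inverse (Y 0 s)) (conc (Y 0 s) (Y s t)) w"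
        using st 0 level_setD[OF W st(3)] by (intro conc_cong) (auto simp: chen)
      also have "\<dots> = Y s t w"
        using gl[OF 0 st(1)] by (simp add: conc_inverse_left group_like_def flip: conc_assoc)
      finally show ?thesis .
    qed
    have "X 0 w = unit w" if "w \<in> W" for w
    proof -
      have "\<Phi> (0, 0) = counit ?V" using \<Phi> 0 by (simp add: dual_rough_def)
      then show ?thesis using 0 that by (simp add: X_def Y_def counit_def) (simp add: unit_def word_def)
    qed
    moreover have "graded_hoelder \<gamma> (?I \<times> ?I) X w" if w: "w \<in> W" for w
    proof -
      have "{\<bar>\<Phi> (s, t) (word w)\<bar> / \<bar>t - s\<bar> powr (\<gamma> * real (length w)) | s t.
            s \<in> ?I \<and> t \<in> ?I \<and> s \<noteq> t} =
          {\<bar>inc X s t w\<bar> / \<bar>t - s\<bar> powr (\<gamma> * real (length w)) | s t. s \<in> ?I \<and> t \<in> ?I \<and> s \<noteq> t}"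
        using w by (intro Collect_cong ex_cong1) (auto simp: inc Y_def)
      moreover have "bdd_above {\<bar>\<Phi> (s, t) (word w)\<bar> / \<bar>t - s\<bar> powr (\<gamma> * real (length w)) | s t.
            s \<in> ?I \<and> t \<in> ?I \<and> s \<noteq> t}"
      proof -
        have "\<forall>w\<in>W. bdd_above {\<bar>\<Phi> (s, t) (word w)\<bar> / \<bar>t - s\<bar> powr (\<gamma> * real (length w)) | s t.
            s \<in> ?I \<and> t \<in> ?I \<and> s \<noteq> t}"
          using \<Phi> unfolding dual_rough_def mem_Collect_eq by (elim conjE)
        from bspec[OF this w] show ?thesis .
      qed
      ultimately show ?thesis using graded_hoelder_iff_bdd_above[where X = X and T = T and \<gamma> = \<gamma> and w = w, OF one] by (simp only:)
    qed
    ultimately have "rough W \<gamma> T X"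
      using gl 0 by (simp add: rough_def X_def)
    then have "X \<in> rough_paths W \<gamma> T" by (simp add: rough_paths_def X_def Y_def)
    moreover have "to_dual W T X = \<Phi>"
    proof (rule extensionalityI[of _ "?I \<times> ?I"])
      show "\<Phi> \<in> extensional (?I \<times> ?I)" using \<Phi> by (simp add: dual_rough_def PiE_iff)
      fix q assume "q \<in> ?I \<times> ?I"
      then obtain s t where q: "q = (s, t)" "s \<in> ?I" "t \<in> ?I" by blast
      show "to_dual W T X q = \<Phi> q"
      proof (rule extensionalityI[of _ ?V])
        show "to_dual W T X q \<in> extensional ?V" using q by (simp add: to_dual_def)
        show "\<Phi> q \<in> extensional ?V" using dual[OF q(2,3)] by (simp add: q dual_def)
        fix p assume p: "p \<in> ?V"
        show "to_dual W T X q p = \<Phi> q p"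
          using pairing_cong[OF p, of "inc X s t" "Y s t"] inc q p by (simp add: eval \<Phi>_eq)
      qed
    qed (simp add: to_dual_def)
    ultimately show ?thesis by blast
  qed
  show ?thesis
    unfolding bij_betw_def using inj into surj by (auto simp: image_iff)
qed

lemma I2_eq:
  assumes "0 < T" "X \<in> R \<gamma> T"
  shows "I2 \<gamma> T X = to_dual (words_upto (level \<gamma>)) T X"
proof -
  have "X t \<in> carrier (G_trunc (level \<gamma>))" if "t \<in> {0..T}" for t
    using assms(2) that by (auto simp: R_def)
  moreover have "pairing p (trunc n x) = pairing p x" if "p \<in> trunc_space n" for p x n
    using that by (rule pairing_cong) (simp add: words_upto_def trunc_def)
  ultimately show ?thesis
    unfolding I2_def to_dual_def
    by (intro restrict_ext) (auto simp: increment_G_trunc intro!: restrict_ext)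
qed

lemma I3_eq:
  assumes "X \<in> R_bar \<gamma> T"
  shows "I3 T X = to_dual UNIV T X"
proof -
  have "X t \<in> carrier G" if "t \<in> {0..T}" for t
    using assms that by (auto simp: R_bar_def)
  then show ?thesis
    unfolding I3_def to_dual_def
    by (intro restrict_ext) (auto simp: increment_G)
qed

text \<open>
  With $n = \lfloor 1/\gamma \rfloor$ one has $\gamma (n+1) > 1$, so the comparison and extension of rough paths apply
  from level $n$ on; they give injectivity and surjectivity of the truncation.
\<close>

lemma bij_betw_I1:
  fixes \<gamma> T :: real
  assumes \<gamma>: "0 < \<gamma>" and T: "0 < T"
  shows "bij_betw (I1 \<gamma> T) (R_bar \<gamma> T) (R \<gamma> T :: (real \<Rightarrow> ('d::finite) series) set)"
proof -
  define n where "n = level \<gamma>"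
  have "1 / \<gamma> < real (Suc n)"
    using \<gamma> by (simp add: n_def level_def) linarith
  then have n: "1 < \<gamma> * real (Suc n)" using \<gamma> by (simp add: field_simps)
  have I1: "I1 \<gamma> T X t w = X t w" if "t \<in> {0..T}" "w \<in> words_upto n" for X :: "real \<Rightarrow> 'd series" and t w
    using that by (simp add: I1_def trunc_def words_upto_def n_def)
  have "I1 \<gamma> T X \<in> R \<gamma> T" if "X \<in> R_bar \<gamma> T" for X :: "real \<Rightarrow> 'd series"
  proof -
    have "rough (words_upto n) \<gamma> T X" using that T by (simp add: R_bar_iff rough_UNIV_iff)
    then have "rough (words_upto n) \<gamma> T (I1 \<gamma> T X)"
      by (rule rough_cong[rotated -1]) (use T I1 in auto)
    then show ?thesis
      using T by (simp add: R_iff n_def[symmetric]) (simp add: I1_def trunc_trunc_space n_def)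
  qed
  moreover have "inj_on (I1 \<gamma> T) (R_bar \<gamma> T :: (real \<Rightarrow> 'd series) set)"
  proof (rule inj_onI)
    fix X Y :: "real \<Rightarrow> 'd series"
    assume X: "X \<in> R_bar \<gamma> T" and Y: "Y \<in> R_bar \<gamma> T" and eq: "I1 \<gamma> T X = I1 \<gamma> T Y"
    have "X t = Y t" if "t \<in> {0..T}" for t
    proof (rule rough_unique[OF _ _ \<gamma> n])
      show "X t w = Y t w" if "t \<in> {0..T}" "w \<in> words_upto n" for t w
        using I1[OF that, of X] I1[OF that, of Y] eq by simp
    qed (use X Y T that in \<open>auto simp: R_bar_iff\<close>)
    then show "X = Y"
      using X Y T by (intro extensionalityI[of X "{0..T}" Y]) (auto simp: R_bar_iff)
  qed
  moreover have "\<exists>Y\<in>R_bar \<gamma> T. I1 \<gamma> T Y = X" if X: "X \<in> R \<gamma> T" for X :: "real \<Rightarrow> 'd series"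
  proof -
    have Xn: "X \<in> extensional {0..T}" "\<forall>t\<in>{0..T}. X t \<in> trunc_space n" "rough (words_upto n) \<gamma> T X"
      using X T by (auto simp: R_iff n_def)
    obtain Y where Y: "rough UNIV \<gamma> T Y" "\<And>t w. w \<in> words_upto n \<Longrightarrow> Y t w = X t w"
      using rough_extend[OF Xn(3) \<gamma> n T] by blast
    let ?Y = "restrict Y {0..T}"
    have "rough UNIV \<gamma> T ?Y"
      by (rule rough_cong[OF _ _ _ Y(1)]) (use T in auto)
    then have "?Y \<in> R_bar \<gamma> T" using T by (simp add: R_bar_iff)
    moreover have "I1 \<gamma> T ?Y = X"
    proof (rule extensionalityI[of _ "{0..T}"])
      fix t assume t: "t \<in> {0..T}"
      have "trunc n (Y t) = trunc n (X t)"
        unfolding trunc_eq_iff using Y(2) by (simp add: words_upto_def)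
      then show "I1 \<gamma> T ?Y t = X t"
        using t Xn(2) by (simp add: I1_def n_def[symmetric] trunc_id)
    qed (use Xn in \<open>auto simp: I1_def\<close>)
    ultimately show ?thesis by blast
  qed
  ultimately show ?thesis
    unfolding bij_betw_def by (auto simp: image_iff)
qed

theorem theorem4p6:
  fixes \<gamma> T :: real
  assumes "0 < \<gamma>" and "\<gamma> < 1" and "0 < T"
  shows "(I1 \<gamma> T \<in> R_bar \<gamma> T \<rightarrow> (R \<gamma> T :: (real \<Rightarrow> ('d::finite) series) set)
      \<and> bij_betw (I1 \<gamma> T) (R_bar \<gamma> T) (R \<gamma> T :: (real \<Rightarrow> 'd series) set))
    \<and> (I2 \<gamma> T \<in> R \<gamma> T \<rightarrow> (R_check \<gamma> T :: (real \<times> real \<Rightarrow> 'd series \<Rightarrow> real) set)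
      \<and> bij_betw (I2 \<gamma> T) (R \<gamma> T) (R_check \<gamma> T :: (real \<times> real \<Rightarrow> 'd series \<Rightarrow> real) set))
    \<and> (I3 T \<in> R_bar \<gamma> T \<rightarrow> (R_hat \<gamma> T :: (real \<times> real \<Rightarrow> 'd series \<Rightarrow> real) set)
      \<and> bij_betw (I3 T) (R_bar \<gamma> T) (R_hat \<gamma> T :: (real \<times> real \<Rightarrow> 'd series \<Rightarrow> real) set))"
proof -
  have 1: "bij_betw (I1 \<gamma> T) (R_bar \<gamma> T) (R \<gamma> T :: (real \<Rightarrow> 'd series) set)"
    using assms by (intro bij_betw_I1)
  have "bij_betw (to_dual (words_upto (level \<gamma>)) T) (R \<gamma> T)
      (R_check \<gamma> T :: (real \<times> real \<Rightarrow> 'd series \<Rightarrow> real) set)"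
    using assms bij_betw_to_dual[OF level_set_words_upto] by (simp add: R_eq R_check_eq)
  then have 2: "bij_betw (I2 \<gamma> T) (R \<gamma> T) (R_check \<gamma> T :: (real \<times> real \<Rightarrow> 'd series \<Rightarrow> real) set)"
    by (subst bij_betw_cong[OF I2_eq[OF assms(3)]])
  have "bij_betw (to_dual UNIV T) (R_bar \<gamma> T) (R_hat \<gamma> T :: (real \<times> real \<Rightarrow> 'd series \<Rightarrow> real) set)"
    using assms bij_betw_to_dual[OF level_set_UNIV] by (simp add: R_bar_eq R_hat_eq)
  then have 3: "bij_betw (I3 T) (R_bar \<gamma> T) (R_hat \<gamma> T :: (real \<times> real \<Rightarrow> 'd series \<Rightarrow> real) set)"
    by (subst bij_betw_cong[OF I3_eq])
  show ?thesis
    using 1 2 3 bij_betw_imp_funcset[OF 1] bij_betw_imp_funcset[OF 2] bij_betw_imp_funcset[OF 3]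
    by simp
qed

end
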